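(* Let $m\ge 0$, $l\ge 1$ and $n\ge 4$ be integers, and let $c_m(\mathcal{C}_n(l))$ be the $m$-cone of the $l$-duplication of the cycle $\mathcal{C}_n$ with $n$ vertices. Let $f_k(x,y)\in\mathbb{Z}[x,y]$ be the polynomials with $f_{-1}=0$, $f_0=1$ and $f_k(x,y)=x f_{k-1}(x,y)-y^2f_{k-2}(x,y)$ for $k\ge 1$. Put $r=\gcd(l,m)$, $s_q=\big(f_{q+1}(m+2l,-l)+l f_q(m+2l,-l)\big)/r^{q+1}$ and $t_q=f_q(m+2l,-l)/r^q$. Then \[ K(c_m(\mathcal{C}_n(l)))\cong \begin{cases} \mathbb{Z}_r^{\,n-2}\oplus\mathbb{Z}_{r s_q}\oplus\mathbb{Z}_{m s_q} & \text{if } n-2=2q+1,\\ \mathbb{Z}_r^{\,n-2}\oplus\mathbb{Z}_{r t_q}\oplus\mathbb{Z}_{m(m+4l)t_q/r} & \text{if } n-2=2q \text{ and } m/r \text{ is odd},\\ \mathbb{Z}_r^{\,n-2}\oplus\mathbb{Z}_{2r t_q}\oplus\mathbb{Z}_{m(m+4l)t_q/(2r)} & \text{if } n-2=2q \text{ and } m/r \text{ is even}. \end{cases} \]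
   Context: For a simple graph $\mathcal{G}$ and an integer $l\ge 1$, the $l$-duplication $\mathcal{G}(l)$ is the multigraph obtained by replacing every edge of $\mathcal{G}$ by $l$ parallel edges. For a multigraph $\mathcal{H}$ and an integer $k\ge 0$, the $k$-cone $c_k(\mathcal{H})$ is the multigraph obtained by adding a new vertex $s$ (the sink) and $k$ parallel edges between $s$ and every vertex of $\mathcal{H}$. The Laplacian is $L=D-A$ ($D$ the diagonal degree matrix, $A$ the adjacency matrix counting edge multiplicities), and the reduced Laplacian $L(\cdot,s)$ is obtained by deleting the row and column of $s$. The critical group $K(c_k(\mathcal{H}))$ is the cokernel $\mathbb{Z}^{V(\mathcal{H})}/\mathrm{Im}\,L(c_k(\mathcal{H}),s)^t$, where $L(c_k(\mathcal{H}),s)=L(\mathcal{H})+kI$. $\mathbb{Z}_d=\mathbb{Z}/d\mathbb{Z}$, with $\mathbb{Z}_0=\mathbb{Z}$. *)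

theory Defs
  imports
    "HOL-Algebra.Product_Groups"
    "HOL-Computational_Algebra.Polynomial"
    "HOL-Library.Multiset"
begin

section \<open>Multigraphs\<close>

text \<open>A finite undirected loopless multigraph: an edge is its two-element set of end
  vertices, and parallel edges are repeated elements of the multiset.\<close>

record 'v mgraph =
  verts :: "'v set"
  edges :: "'v set multiset"

definition multigraph :: "'v mgraph \<Rightarrow> bool" where
  "multigraph G \<longleftrightarrow> finite (verts G) \<and> (\<forall>e\<in>#edges G. e \<subseteq> verts G \<and> card e = 2)"

definition simple_graph :: "'v mgraph \<Rightarrow> bool" where
  "simple_graph G \<longleftrightarrow> multigraph G \<and> (\<forall>e. count (edges G) e \<le> 1)"

definition cycle_graph :: "nat \<Rightarrow> nat mgraph" where
  "cycle_graph n =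
     \<lparr>verts = {..<n}, edges = mset_set ((\<lambda>i. {i, (i + 1) mod n}) ` {..<n})\<rparr>"

definition duplication :: "nat \<Rightarrow> 'v mgraph \<Rightarrow> 'v mgraph" where
  "duplication l G = \<lparr>verts = verts G, edges = repeat_mset l (edges G)\<rparr>"

text \<open>In a cone, \<^term>\<open>None\<close> is the new vertex (the sink) and \<^term>\<open>Some v\<close> is the
  copy of the old vertex \<^term>\<open>v\<close>.\<close>

definition cone :: "nat \<Rightarrow> 'v mgraph \<Rightarrow> 'v option mgraph" where
  "cone k H =
     \<lparr>verts = insert None (Some ` verts H),
      edges = image_mset (\<lambda>e. Some ` e) (edges H)
                + (\<Sum>v\<in>verts H. replicate_mset k {None, Some v})\<rparr>"

section \<open>Laplacian and critical group\<close>

definition vdegree :: "'v mgraph \<Rightarrow> 'v \<Rightarrow> nat" where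
  "vdegree G v = size {#e \<in># edges G. v \<in> e#}"

definition adjacency :: "'v mgraph \<Rightarrow> 'v \<Rightarrow> 'v \<Rightarrow> nat" where
  "adjacency G u v = (if u = v then 0 else count (edges G) {u, v})"

definition laplacian :: "'v mgraph \<Rightarrow> 'v \<Rightarrow> 'v \<Rightarrow> int" where
  "laplacian G u v = (if u = v then int (vdegree G u) else 0) - int (adjacency G u v)"

text \<open>The image of \<open>M\<^sup>t\<close> acting on \<open>\<int>\<^sup>W\<close>, for an integer matrix \<open>M\<close> with rows and
  columns indexed by \<open>W\<close>.\<close>

definition transpose_image :: "'v set \<Rightarrow> ('v \<Rightarrow> 'v \<Rightarrow> int) \<Rightarrow> ('v \<Rightarrow> int) set" where
  "transpose_image W M =
     (\<lambda>x. \<lambda>u\<in>W. \<Sum>v\<in>W. M v u * x v) ` carrier (product_group W (\<lambda>_. integer_group))"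

text \<open>Deleting the row and the column of \<open>s\<close> amounts to using only the indices in
  \<^term>\<open>verts G - {s}\<close>.\<close>

definition critical_group :: "'v mgraph \<Rightarrow> 'v \<Rightarrow> ('v \<Rightarrow> int) set monoid" where
  "critical_group G s =
     product_group (verts G - {s}) (\<lambda>_. integer_group)
       Mod transpose_image (verts G - {s}) (laplacian G)"

text \<open>\<open>\<int>/d\<int>\<close> for an integer \<open>d\<close>; this is \<open>\<int>\<close> for \<open>d = 0\<close>.\<close>

definition Zmod :: "int \<Rightarrow> int monoid" where
  "Zmod d = integer_mod_group (nat \<bar>d\<bar>)"

section \<open>The polynomials\<close>

text \<open>The type \<^typ>\<open>int poly poly\<close> is read as \<open>\<int>[x][y]\<close>: the variable of the outer
  polynomial is \<open>y\<close>.\<close>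

definition varX :: "int poly poly" where "varX = [:[:0, 1:]:]"

definition varY :: "int poly poly" where "varY = [:0, 1:]"

definition eval2 :: "int poly poly \<Rightarrow> int \<Rightarrow> int \<Rightarrow> int" where
  "eval2 p x y = poly (poly p [:y:]) x"

text \<open>Only the indices \<open>k \<ge> -1\<close> are meaningful.\<close>

function fpoly :: "int \<Rightarrow> int poly poly" where
  "fpoly k =
     (if k < 0 then 0 else if k = 0 then 1
      else varX * fpoly (k - 1) - varY\<^sup>2 * fpoly (k - 2))"
  by pat_completeness auto
termination by (relation "measure (\<lambda>k. nat (k + 1))") auto

declare fpoly.simps [simp del]

definition s_val :: "nat \<Rightarrow> nat \<Rightarrow> nat \<Rightarrow> int" where
  "s_val l m q =
     (eval2 (fpoly (int q + 1)) (int m + 2 * int l) (- int l)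
        + int l * eval2 (fpoly (int q)) (int m + 2 * int l) (- int l))
       div int (gcd l m) ^ (q + 1)"

definition t_val :: "nat \<Rightarrow> nat \<Rightarrow> nat \<Rightarrow> int" where
  "t_val l m q =
     eval2 (fpoly (int q)) (int m + 2 * int l) (- int l) div int (gcd l m) ^ q"

section \<open>Consistency checks\<close>

lemma multigraph_duplication: "multigraph G \<Longrightarrow> multigraph (duplication l G)"
  by (auto simp: multigraph_def duplication_def simp flip: count_greater_zero_iff)

lemma multigraph_cone:
  assumes "multigraph H"
  shows "multigraph (cone k H)"
proof -
  have in_sum: "e \<in># (\<Sum>w\<in>W. replicate_mset k {None, Some w}) \<Longrightarrow> \<exists>w\<in>W. e = {None, Some w}"
    if "finite W" for e :: "'a option set" and W
    using that by (induction W) (auto split: if_splits)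
  have "e \<subseteq> insert None (Some ` verts H) \<and> card e = 2" if "e \<in># edges (cone k H)" for e
  proof -
    have "e \<in># image_mset (\<lambda>e. Some ` e) (edges H) \<or>
        e \<in># (\<Sum>w\<in>verts H. replicate_mset k {None, Some w})"
      using that by (simp add: cone_def)
    moreover have "\<exists>w\<in>verts H. e = {None, Some w}"
      if "e \<in># (\<Sum>w\<in>verts H. replicate_mset k {None, Some w})"
      using assms that by (intro in_sum) (simp_all add: multigraph_def)
    moreover have "\<exists>e'\<in>#edges H. e = Some ` e'" if "e \<in># image_mset (\<lambda>e. Some ` e) (edges H)"
      using that by auto
    ultimately consider e' where "e' \<in># edges H" "e = Some ` e'"
      | v where "v \<in> verts H" "e = {None, Some v}"
      by metis
    then show ?thesis
      using assms by cases (auto simp: multigraph_def card_image)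
  qed
  then show ?thesis
    using assms by (auto simp: multigraph_def cone_def)
qed

lemma simple_graph_cycle_graph:
  assumes "n \<ge> 2"
  shows "simple_graph (cycle_graph n)"
proof -
  have "i \<noteq> Suc i mod n" if "i < n" for i
    using that assms by (cases "Suc i = n") auto
  then show ?thesis
    using assms by (auto simp: simple_graph_def multigraph_def cycle_graph_def count_mset_set')
qed

lemma laplacian_cone:
  assumes "multigraph H" "u \<in> verts H" "v \<in> verts H"
  shows "laplacian (cone k H) (Some u) (Some v) = laplacian H u v + (if u = v then int k else 0)"
proof -
  have fin: "finite (verts H)"
    using assms by (simp add: multigraph_def)
  have filter_mset_replicate: "filter_mset P (replicate_mset i e) = (if P e then replicate_mset i e else {#})"
    for P i and e :: "'a option set"
    by (induction i) auto
  have "filter_mset ((\<in>) (Some u)) (\<Sum>w\<in>W. replicate_mset k {None, Some w}) =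
      (if u \<in> W then replicate_mset k {None, Some u} else {#})" if "finite W" for W
    using that by (induction W) (auto simp: filter_mset_replicate)
  with fin assms have deg: "vdegree (cone k H) (Some u) = vdegree H u + k"
    by (auto simp: vdegree_def cone_def filter_mset_image_mset inj_image_mem_iff)
  have inj: "inj (\<lambda>e. Some ` e)"
    by (auto simp: inj_on_def inj_image_eq_iff)
  have "count (image_mset (\<lambda>e. Some ` e) M) (Some ` {u, v}) = count M {u, v}" for M
    by (induction M) (auto simp: inj_image_eq_iff simp del: image_insert)
  moreover have "count (\<Sum>w\<in>verts H. replicate_mset k {None, Some w}) {Some u, Some v} = 0"
    unfolding count_sum by (intro sum.neutral ballI) (auto simp: set_eq_iff)
  ultimately have "adjacency (cone k H) (Some u) (Some v) = adjacency H u v"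
    by (simp add: adjacency_def cone_def)
  with deg show ?thesis
    by (cases "u = v") (auto simp: laplacian_def)
qed

text \<open>All divisions in \<^const>\<open>s_val\<close>, \<^const>\<open>t_val\<close> and in the theorem are exact.\<close>

lemma eval2_fpoly:
  "eval2 (fpoly (-1)) x y = 0" "eval2 (fpoly 0) x y = 1"
  "k \<ge> 1 \<Longrightarrow> eval2 (fpoly k) x y = x * eval2 (fpoly (k - 1)) x y - y\<^sup>2 * eval2 (fpoly (k - 2)) x y"
  by (simp_all add: fpoly.simps[of "-1"] fpoly.simps[of 0] fpoly.simps[of k] eval2_def varX_def varY_def power2_eq_square)

lemma power_dvd_eval2_fpoly:
  assumes "r dvd x" "r dvd y"
  shows "r ^ q dvd eval2 (fpoly (int q)) x y"
proof (induction q rule: less_induct)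
  case (less q)
  consider "q = 0" | "q = 1" | p where "q = Suc (Suc p)"
    by (metis One_nat_def not0_implies_Suc)
  then show ?case
  proof cases
    case 3
    have "r * r ^ Suc p dvd x * eval2 (fpoly (int (Suc p))) x y"
      using less[of "Suc p"] assms 3 by (intro mult_dvd_mono) auto
    moreover have "r\<^sup>2 * r ^ p dvd y\<^sup>2 * eval2 (fpoly (int p)) x y"
      using less[of p] assms 3 by (intro mult_dvd_mono dvd_power_same) auto
    ultimately have "r ^ q dvd x * eval2 (fpoly (int (Suc p))) x y - y\<^sup>2 * eval2 (fpoly (int p)) x y"
      using 3 by (intro dvd_diff) (simp_all add: power2_eq_square mult.assoc)
    moreover have "int q - 1 = int (Suc p)" "int q - 2 = int p"
      using 3 by auto
    moreover have "int q \<ge> 1"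
      using 3 by simp
    ultimately show ?thesis
      by (simp only: eval2_fpoly(3)[of "int q"])
  qed (use assms in \<open>auto simp: eval2_fpoly\<close>)
qed

lemma s_val_exact:
  "s_val l m q * int (gcd l m) ^ (q + 1) =
     eval2 (fpoly (int q + 1)) (int m + 2 * int l) (- int l)
       + int l * eval2 (fpoly (int q)) (int m + 2 * int l) (- int l)"
proof -
  let ?r = "int (gcd l m)"
  have r: "?r dvd int m + 2 * int l" "?r dvd - int l" "?r dvd int l"
    by (auto intro!: dvd_add dvd_mult)
  have "?r * ?r ^ q dvd int l * eval2 (fpoly (int q)) (int m + 2 * int l) (- int l)"
    by (intro mult_dvd_mono power_dvd_eval2_fpoly r)
  then have "?r ^ (q + 1) dvd eval2 (fpoly (int q + 1)) (int m + 2 * int l) (- int l)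
      + int l * eval2 (fpoly (int q)) (int m + 2 * int l) (- int l)"
    using power_dvd_eval2_fpoly[OF r(1,2), of "Suc q"] by (intro dvd_add) (simp_all add: add.commute)
  then show ?thesis
    unfolding s_val_def by (rule dvd_div_mult_self)
qed

lemma t_val_exact:
  "t_val l m q * int (gcd l m) ^ q = eval2 (fpoly (int q)) (int m + 2 * int l) (- int l)"
  unfolding t_val_def by (rule dvd_div_mult_self, rule power_dvd_eval2_fpoly) (auto intro!: dvd_add dvd_mult)

lemma last_factor_exact:
  "int (gcd l m) dvd int m * (int m + 4 * int l) * t"
  "even (m div gcd l m) \<Longrightarrow> 2 * int (gcd l m) dvd int m * (int m + 4 * int l) * t"
proof -
  show "int (gcd l m) dvd int m * (int m + 4 * int l) * t"
    by (simp add: mult.assoc)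
  assume "even (m div gcd l m)"
  then have "2 * gcd l m dvd m"
    by (metis dvd_mult_div_cancel dvd_triv_right gcd_dvd2 mult.commute mult_dvd_mono dvd_refl)
  then have "2 * int (gcd l m) dvd int m"
    by (metis int_dvd_int_iff of_nat_mult of_nat_numeral)
  then show "2 * int (gcd l m) dvd int m * (int m + 4 * int l) * t"
    by (simp add: mult.assoc)
qed

end

theory Submission
  imports Defs "HOL-Library.Function_Algebras"
begin

text \<open>
  Write \<open>l = r b\<close>, \<open>m = r c\<close> and \<open>a = c + 2b\<close>, so that \<open>a\<close> and \<open>b\<close> are coprime and the reduced
  Laplacian is \<open>r\<close> times the circulant matrix with \<open>a\<close> on the diagonal and \<open>-b\<close> next to it. In
  the cokernel \<open>M\<close> of this circulant the unit vectors \<open>e\<^sub>j\<close> satisfy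
  \<open>b e\<^sub>j - a e\<^sub>j\<^sub>+\<^sub>1 + b e\<^sub>j\<^sub>+\<^sub>2 = 0\<close>. Symmetric differences \<open>e\<^sub>c\<^sub>+\<^sub>i - e\<^sub>c\<^sub>-\<^sub>i\<close> obey the same recurrence in
  \<open>i\<close>, and since \<open>e\<close> has period \<open>n\<close> this yields \<open>t (e\<^sub>j\<^sub>+\<^sub>2 - e\<^sub>j) = 0\<close> for even \<open>n\<close>, respectively
  \<open>s (e\<^sub>j\<^sub>+\<^sub>1 - e\<^sub>j) = 0\<close> for odd \<open>n\<close>. Consequently \<open>M\<close> is killed by an integer prime to \<open>b\<close>
  (by \<open>0\<close> if \<open>m = 0\<close>, but then \<open>b = 1\<close>), so \<open>b\<close> is invertible on \<open>M\<close>, the recurrence becomes monic and \<open>M\<close> is generated by \<open>e\<^sub>0\<close> and \<open>e\<^sub>1\<close>. A base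
  change in \<open>GL\<^sub>2(\<int>)\<close> turns the relations between these two into \<open>d\<^sub>1 f\<^sub>0 = 0\<close> and \<open>d\<^sub>2 f\<^sub>1 = 0\<close>; there
  are no others, because the integer solutions of the monic recurrence dual to \<open>f\<^sub>0\<close> and \<open>f\<^sub>1\<close> have
  period \<open>n\<close> modulo \<open>d\<^sub>1\<close> and \<open>d\<^sub>2\<close>. These two dual solutions together with the coordinates
  \<open>2, \<dots>, n - 1\<close> form a unimodular matrix, which is why multiplying the circulant by \<open>r\<close> only adds
  \<open>n - 2\<close> factors \<open>\<int>\<^sub>r\<close> and multiplies \<open>d\<^sub>1\<close> and \<open>d\<^sub>2\<close> by \<open>r\<close>.
\<close>

section \<open>A linear recurrence modulo a subgroup\<close>

lemma of_int_fun_apply: "(of_int k :: 'a \<Rightarrow> 'b::comm_ring_1) u = of_int k"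
  by (cases k rule: int_cases2) auto

text \<open>\<open>lucas a b k\<close> is the value of \<open>f\<^sub>k\<close> at \<open>(a, -b)\<close>.\<close>

fun lucas :: "int \<Rightarrow> int \<Rightarrow> nat \<Rightarrow> int" where
  "lucas a b 0 = 1"
| "lucas a b (Suc 0) = a"
| "lucas a b (Suc (Suc k)) = a * lucas a b (Suc k) - b\<^sup>2 * lucas a b k"

text \<open>Integer scalars act through \<open>of_int\<close>, so one notion covers subgroups of the
  function ring \<open>nat \<Rightarrow> int\<close> and the multiples of \<open>d\<close> in
  \<open>int\<close>. The period identities below are applied to both.\<close>

locale int_submodule =
  fixes S :: "'r::comm_ring_1 set"
  assumes zero_mem: "0 \<in> S"
    and add_mem: "x \<in> S \<Longrightarrow> y \<in> S \<Longrightarrow> x + y \<in> S"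
    and scale_mem: "x \<in> S \<Longrightarrow> of_int k * x \<in> S"
begin

lemma comb_mem: "x \<in> S \<Longrightarrow> y \<in> S \<Longrightarrow> of_int i * x + of_int k * y \<in> S"
  by (intro add_mem scale_mem)

lemma diff_mem: "x \<in> S \<Longrightarrow> y \<in> S \<Longrightarrow> x - y \<in> S"
  using comb_mem[of x y 1 "-1"] by simp

lemma sum_mem: "(\<And>i. i \<in> A \<Longrightarrow> f i \<in> S) \<Longrightarrow> sum f A \<in> S"
  by (induction A rule: infinite_finite_induct) (auto intro: zero_mem add_mem)

text \<open>The leading coefficient \<open>b\<close> cannot be divided by, so each step of the
  recurrence costs one factor \<open>b\<close>. The bound \<open>i \<le> k\<close> is there because
  the symmetric differences below follow the recurrence only while their lower index stays above the
  truncation at 0.\<close>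

lemma recurrence_power:
  assumes "\<And>i. i \<le> k \<Longrightarrow> of_int b * \<psi> i - of_int a * \<psi> (i + 1) + of_int b * \<psi> (i + 2) \<in> S"
  shows "of_int (b ^ (k + 1)) * \<psi> (k + 2)
    - (of_int (lucas a b (k + 1)) * \<psi> 1 - of_int (b * lucas a b k) * \<psi> 0) \<in> S"
  using assms
proof (induction a b k rule: lucas.induct)
  case (1 a b)
  show ?case
    using "1"[of 0] by (simp add: algebra_simps numeral_eq_Suc)
next
  case (2 a b)
  have "of_int a * (of_int b * \<psi> 0 - of_int a * \<psi> (0 + 1) + of_int b * \<psi> (0 + 2)) +
      of_int b * (of_int b * \<psi> 1 - of_int a * \<psi> (1 + 1) + of_int b * \<psi> (1 + 2)) \<in> S"
    by (intro comb_mem "2") auto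
  then show ?case
    by (simp add: algebra_simps numeral_eq_Suc)
next
  case (3 a b k)
  let ?X = "\<lambda>k. of_int (b ^ (k + 1)) * \<psi> (k + 2)
    - (of_int (lucas a b (k + 1)) * \<psi> 1 - of_int (b * lucas a b k) * \<psi> 0)"
  let ?\<rho> = "of_int b * \<psi> (k + 2) - of_int a * \<psi> (k + 3) + of_int b * \<psi> (k + 4)"
  have h1: "?\<rho> \<in> S"
    using "3.prems"[of "k + 2"] by (simp add: numeral_eq_Suc)
  have h2: "?X (Suc k) \<in> S"
    by (rule "3.IH"(1)) (use "3.prems" in simp)
  have h3: "?X k \<in> S"
    by (rule "3.IH"(2)) (use "3.prems" in simp)
  have "of_int (b ^ (k + 2)) * ?\<rho> + (of_int a * ?X (Suc k) + of_int (- (b\<^sup>2)) * ?X k) \<in> S"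
    by (rule add_mem[OF scale_mem[OF h1] comb_mem[OF h2 h3]])
  also have "of_int (b ^ (k + 2)) * ?\<rho> + (of_int a * ?X (Suc k) + of_int (- (b\<^sup>2)) * ?X k) = ?X (Suc (Suc k))"
    by (simp add: numeral_eq_Suc algebra_simps)
  finally show ?case .
qed

lemma even_period:
  assumes "\<And>j. of_int b * \<phi> j - of_int a * \<phi> (j + 1) + of_int b * \<phi> (j + 2) \<in> S"
  shows "of_int (b ^ q) * (\<phi> (j + (2 * q + 2)) - \<phi> j)
    - of_int (lucas a b q) * (\<phi> (j + q + 2) - \<phi> (j + q)) \<in> S"
proof (cases q)
  case 0
  then show ?thesis
    by (simp add: zero_mem)
next
  case (Suc k)
  define c where "c = j + q + 1"
  \<comment> \<open>\<open>c\<close> is the midpoint of \<open>j\<close> and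
    \<open>j + (2 * q + 2)\<close>. One initial term disappears because \<open>\<psi> 0 = 0\<close>,
    and \<open>\<psi> (q + 1)\<close> is the full difference.\<close>
  define \<psi> where "\<psi> i = \<phi> (c + i) - \<phi> (c - i)" for i
  have "of_int b * \<psi> i - of_int a * \<psi> (i + 1) + of_int b * \<psi> (i + 2) \<in> S" if "i \<le> k" for i
  proof -
    have *: "c - i = c - (i + 2) + 2" "c - (i + 1) = c - (i + 2) + 1"
      using that Suc by (auto simp: c_def)
    have "(of_int b * \<phi> (c + i) - of_int a * \<phi> (c + i + 1) + of_int b * \<phi> (c + i + 2)) -
      (of_int b * \<phi> (c - (i + 2)) - of_int a * \<phi> (c - (i + 2) + 1) + of_int b * \<phi> (c - (i + 2) + 2)) \<in> S"
      by (intro diff_mem assms)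
    then show ?thesis
      unfolding \<psi>_def * by (simp add: algebra_simps)
  qed
  from recurrence_power[of k, OF this] show ?thesis
    by (simp add: \<psi>_def c_def Suc algebra_simps numeral_eq_Suc)
qed

lemma odd_period:
  assumes "\<And>j. of_int b * \<phi> j - of_int a * \<phi> (j + 1) + of_int b * \<phi> (j + 2) \<in> S"
  shows "of_int (b ^ (q + 1)) * (\<phi> (j + (2 * q + 3)) - \<phi> j)
    - of_int (lucas a b (q + 1) + b * lucas a b q) * (\<phi> (j + (q + 1) + 1) - \<phi> (j + (q + 1))) \<in> S"
proof -
  define c where "c = j + q + 1"
  \<comment> \<open>The centre of symmetry lies halfway between \<open>c\<close> and
    \<open>c + 1\<close>. So \<open>\<psi> 0 = - \<psi> 1\<close>, and the two initial terms merge
    into one.\<close>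
  define \<psi> where "\<psi> i = \<phi> (c + i) - \<phi> (c + 1 - i)" for i
  have "of_int b * \<psi> i - of_int a * \<psi> (i + 1) + of_int b * \<psi> (i + 2) \<in> S" if "i \<le> q" for i
  proof -
    have *: "c + 1 - i = c + 1 - (i + 2) + 2" "c + 1 - (i + 1) = c + 1 - (i + 2) + 1"
      using that by (auto simp: c_def)
    have "(of_int b * \<phi> (c + i) - of_int a * \<phi> (c + i + 1) + of_int b * \<phi> (c + i + 2)) -
      (of_int b * \<phi> (c + 1 - (i + 2)) - of_int a * \<phi> (c + 1 - (i + 2) + 1) + of_int b * \<phi> (c + 1 - (i + 2) + 2)) \<in> S"
      by (intro diff_mem assms)
    then show ?thesis
      unfolding \<psi>_def * by (simp add: algebra_simps)
  qed
  from recurrence_power[of q, OF this] show ?thesis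
    by (simp add: \<psi>_def c_def algebra_simps numeral_eq_Suc)
qed

end

lemma int_submodule_multiples: "int_submodule {x. (d::int) dvd x}"
  by unfold_locales auto

section \<open>The circulant matrix\<close>

text \<open>Vectors are functions on all of \<open>nat\<close>, constrained only below
  \<open>n\<close>. The predecessor is \<open>(u + n - 1) mod n\<close> because \<open>u - 1\<close>
  would truncate at 0.\<close>

definition circulant_image :: "nat \<Rightarrow> int \<Rightarrow> int \<Rightarrow> (nat \<Rightarrow> int) set" where
  "circulant_image n a b =
    {x. \<exists>y. \<forall>u<n. x u = a * y u - b * y (Suc u mod n) - b * y ((u + n - 1) mod n)}"

text \<open>Reducing the index modulo \<open>n\<close> lets \<open>j\<close> range over all
  naturals, so the recurrence needs no separate case for wrapping around.\<close>

definition cyc_unit :: "nat \<Rightarrow> nat \<Rightarrow> nat \<Rightarrow> int" where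
  "cyc_unit n j = (\<lambda>u. if u = j mod n then 1 else 0)"

lemma cyc_unit_add: "cyc_unit n (j + n) = cyc_unit n j" "cyc_unit n (j + n * k) = cyc_unit n j"
  by (simp_all add: cyc_unit_def)

lemma circulant_image_cong:
  assumes "x \<in> circulant_image n a b" "\<And>u. u < n \<Longrightarrow> x u = x' u"
  shows "x' \<in> circulant_image n a b"
proof -
  obtain y where "\<forall>u<n. x u = a * y u - b * y (Suc u mod n) - b * y ((u + n - 1) mod n)"
    using assms(1) unfolding circulant_image_def by blast
  then show ?thesis
    unfolding circulant_image_def using assms(2) by (intro CollectI exI[of _ y]) simp
qed

lemma int_submodule_circulant: "int_submodule (circulant_image n a b)"
proof
  show "0 \<in> circulant_image n a b"
    by (auto simp: circulant_image_def intro!: exI[of _ "\<lambda>_. 0"])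
next
  fix x x' :: "nat \<Rightarrow> int"
  assume "x \<in> circulant_image n a b" "x' \<in> circulant_image n a b"
  then obtain y y' where
    "\<forall>u<n. x u = a * y u - b * y (Suc u mod n) - b * y ((u + n - 1) mod n)"
    "\<forall>u<n. x' u = a * y' u - b * y' (Suc u mod n) - b * y' ((u + n - 1) mod n)"
    unfolding circulant_image_def by blast
  then show "x + x' \<in> circulant_image n a b"
    unfolding circulant_image_def
    by (intro CollectI exI[of _ "\<lambda>u. y u + y' u"]) (simp add: ring_distribs)
next
  fix x :: "nat \<Rightarrow> int" and k
  assume "x \<in> circulant_image n a b"
  then obtain y where
    "\<forall>u<n. x u = a * y u - b * y (Suc u mod n) - b * y ((u + n - 1) mod n)"
    unfolding circulant_image_def by blast
  then show "of_int k * x \<in> circulant_image n a b"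
    unfolding circulant_image_def
    by (intro CollectI exI[of _ "\<lambda>u. k * y u"]) (simp add: ring_distribs mult.left_commute of_int_fun_apply)
qed

lemma Suc_mod_eq_iff: "Suc i mod n = Suc j mod n \<longleftrightarrow> i mod n = j mod n"
  for i j n :: nat
  by (auto simp: mod_Suc)

lemma pred_mod_Suc: "Suc ((u + n - 1) mod n) mod n = u" if "u < n" for u n :: nat
  using that by (simp add: mod_Suc_eq)

lemma Suc_mod_pred: "(Suc u mod n + n - 1) mod n = u" if "u < n" for u n :: nat
  using that by (cases "Suc u = n") auto

text \<open>Below \<open>n\<close>, this vector is the image of
  \<open>- cyc_unit n (j + 1)\<close>.\<close>

lemma cyc_unit_recurrence:
  "of_int b * cyc_unit n j - of_int a * cyc_unit n (j + 1) + of_int b * cyc_unit n (j + 2)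
    \<in> circulant_image n a b"
proof -
  have "(of_int b * cyc_unit n j - of_int a * cyc_unit n (j + 1) + of_int b * cyc_unit n (j + 2)) u =
    a * - cyc_unit n (j + 1) u - b * - cyc_unit n (j + 1) (Suc u mod n)
      - b * - cyc_unit n (j + 1) ((u + n - 1) mod n)" if "u < n" for u
  proof -
    have "Suc u mod n = (j + 1) mod n \<longleftrightarrow> u = j mod n"
      using Suc_mod_eq_iff[of u n j] that by simp
    moreover have "(u + n - 1) mod n = (j + 1) mod n \<longleftrightarrow> u = (j + 2) mod n"
      using Suc_mod_eq_iff[of "(u + n - 1) mod n" n "j + 1"] pred_mod_Suc[OF that] by simp
    ultimately show ?thesis
      by (simp add: cyc_unit_def of_int_fun_apply)
  qed
  then show ?thesis
    unfolding circulant_image_def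
    by (intro CollectI exI[of _ "\<lambda>u. - cyc_unit n (j + 1) u"] allI impI)
qed

lemma sum_fun_apply: "sum f A u = (\<Sum>v\<in>A. f v u)"
  by (induction A rule: infinite_finite_induct) auto

lemma cyc_unit_expansion:
  assumes "u < n"
  shows "(\<Sum>v<n. of_int (x v) * cyc_unit n v) u = x u"
proof -
  have "(\<Sum>v<n. of_int (x v) * cyc_unit n v) u = (\<Sum>v<n. x v * (if u = v then 1 else 0))"
    unfolding sum_fun_apply by (intro sum.cong) (auto simp: cyc_unit_def of_int_fun_apply)
  also have "\<dots> = x u"
    using assms by (subst sum.mono_neutral_right[of _ "{u}"]) auto
  finally show ?thesis .
qed

section \<open>Dual solutions of the monic recurrence\<close>

fun rec_seq :: "int \<Rightarrow> int \<Rightarrow> int \<Rightarrow> nat \<Rightarrow> int" where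
  "rec_seq c x y 0 = x"
| "rec_seq c x y (Suc 0) = y"
| "rec_seq c x y (Suc (Suc k)) = c * rec_seq c x y (Suc k) - rec_seq c x y k"

text \<open>As \<open>b'\<close> inverts \<open>b\<close> modulo \<open>d\<close>, multiplying the
  monic recurrence by \<open>b\<close> gives back the original one.\<close>

lemma rec_seq_mod_recurrence:
  assumes "d dvd b * b' - 1"
  shows "d dvd b * rec_seq (a * b') x y j - a * rec_seq (a * b') x y (j + 1) + b * rec_seq (a * b') x y (j + 2)"
proof -
  have "d dvd (b * b' - 1) * (a * rec_seq (a * b') x y (Suc j))"
    using assms by (rule dvd_mult2)
  then show ?thesis
    by (simp add: algebra_simps)
qed

text \<open>The matrix is symmetric, so reindexing moves its shifts from \<open>y\<close> to
  \<open>\<phi>\<close>. The coefficient of each \<open>y u\<close> is then, up to sign, the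
  recurrence for \<open>\<phi>\<close> with wrapped indices.\<close>

lemma circulant_functional:
  fixes \<phi> :: "nat \<Rightarrow> int"
  assumes rec: "\<And>j. d dvd b * \<phi> j - a * \<phi> (j + 1) + b * \<phi> (j + 2)"
    and per: "\<And>j. d dvd \<phi> (j + n) - \<phi> j"
    and x: "x \<in> circulant_image n a b"
  shows "d dvd (\<Sum>u<n. \<phi> u * x u)"
proof -
  obtain y where y: "\<forall>u<n. x u = a * y u - b * y (Suc u mod n) - b * y ((u + n - 1) mod n)"
    using x unfolding circulant_image_def by blast
  have bij: "bij_betw (\<lambda>u. Suc u mod n) {..<n} {..<n}"
    by (rule bij_betw_byWitness[where f' = "\<lambda>u. (u + n - 1) mod n"])
      (auto simp del: One_nat_def simp: Suc_mod_pred pred_mod_Suc)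
  have succ: "(\<Sum>u<n. \<phi> u * y (Suc u mod n)) = (\<Sum>v<n. \<phi> ((v + n - 1) mod n) * y v)"
    by (subst sum.reindex_bij_betw[OF bij, symmetric], rule sum.cong)
      (simp_all add: Suc_mod_pred del: One_nat_def)
  have pred: "(\<Sum>v<n. \<phi> v * y ((v + n - 1) mod n)) = (\<Sum>u<n. \<phi> (Suc u mod n) * y u)"
    by (subst sum.reindex_bij_betw[OF bij, symmetric], rule sum.cong)
      (simp_all add: Suc_mod_pred del: One_nat_def)
  have "(\<Sum>u<n. \<phi> u * x u) =
      (\<Sum>u<n. a * (\<phi> u * y u) - b * (\<phi> u * y (Suc u mod n)) - b * (\<phi> u * y ((u + n - 1) mod n)))"
    using y by (intro sum.cong) (simp_all add: right_diff_distrib mult.left_commute del: One_nat_def)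
  also have "\<dots> = a * (\<Sum>u<n. \<phi> u * y u) - b * (\<Sum>u<n. \<phi> ((u + n - 1) mod n) * y u)
      - b * (\<Sum>u<n. \<phi> (Suc u mod n) * y u)"
    by (simp only: sum_subtractf sum_distrib_left[symmetric] succ pred)
  also have "\<dots> = (\<Sum>u<n. (a * \<phi> u - b * \<phi> ((u + n - 1) mod n) - b * \<phi> (Suc u mod n)) * y u)"
    by (simp add: sum_distrib_left sum_subtractf[symmetric] algebra_simps del: One_nat_def)
  finally have eq: "(\<Sum>u<n. \<phi> u * x u) =
    (\<Sum>u<n. (a * \<phi> u - b * \<phi> ((u + n - 1) mod n) - b * \<phi> (Suc u mod n)) * y u)" .
  \<comment> \<open>\<open>\<phi>\<close> has period \<open>n\<close> only modulo \<open>d\<close>,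
    so wrapped values are exchanged for unwrapped ones. The recurrence is used at
    \<open>u + n - 1\<close>, which also serves \<open>u = 0\<close>.\<close>
  have "d dvd a * \<phi> u - b * \<phi> ((u + n - 1) mod n) - b * \<phi> (Suc u mod n)" if "u < n" for u
  proof -
    have pred: "d dvd \<phi> (u + n - 1) - \<phi> ((u + n - 1) mod n)"
    proof (cases u)
      case (Suc w)
      then show ?thesis
        using per[of w] that by simp
    qed (use that in simp)
    have "d dvd \<phi> (u + 1 + n) - \<phi> (u + 1) + (\<phi> (u + 1) - \<phi> (Suc u mod n))"
    proof (rule dvd_add[OF per])
      show "d dvd \<phi> (u + 1) - \<phi> (Suc u mod n)"
        using per[of 0] that by (cases "Suc u = n") auto
    qed
    then have succ: "d dvd \<phi> (u + 1 + n) - \<phi> (Suc u mod n)"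
      by simp
    have "d dvd b * \<phi> (u + n - 1) - a * \<phi> (u + n) + b * \<phi> (u + 1 + n)"
      using rec[of "u + n - 1"] that by simp
    then have "d dvd b * (\<phi> (u + n - 1) - \<phi> ((u + n - 1) mod n)) + b * (\<phi> (u + 1 + n) - \<phi> (Suc u mod n))
      - a * (\<phi> (u + n) - \<phi> u) - (b * \<phi> (u + n - 1) - a * \<phi> (u + n) + b * \<phi> (u + 1 + n))"
      by (rule dvd_diff[OF dvd_diff[OF dvd_add[OF dvd_mult[OF pred] dvd_mult[OF succ]] dvd_mult[OF per]]])
    also have "\<dots> = a * \<phi> u - b * \<phi> ((u + n - 1) mod n) - b * \<phi> (Suc u mod n)"
      by (simp add: algebra_simps)
    finally show ?thesis .
  qed
  then show ?thesis
    unfolding eq by (intro dvd_sum dvd_mult2) auto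
qed

text \<open>Modulo the image, \<open>e\<^sub>j = \<phi>\<^sub>j f\<^sub>0 + \<chi>\<^sub>j f\<^sub>1\<close> with \<open>f\<^sub>0 = p\<^sub>0 e\<^sub>0 + p\<^sub>1 e\<^sub>1\<close> and
  \<open>f\<^sub>1 = p\<^sub>2 e\<^sub>0 + p\<^sub>3 e\<^sub>1\<close>.\<close>

lemma circulant_cokernel:
  fixes n :: nat and a b b' d1 d2 p0 p1 p2 p3 :: int
  defines "\<phi> \<equiv> rec_seq (a * b') p3 (- p2)" and "\<chi> \<equiv> rec_seq (a * b') (- p1) p0"
  assumes det: "p0 * p3 - p1 * p2 = 1"
    and inv: "d1 * d2 dvd b * b' - 1"
    and rel1: "\<And>j. of_int d1 * (of_int p0 * cyc_unit n j + of_int p1 * cyc_unit n (j + 1)) \<in> circulant_image n a b"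
    and rel2: "\<And>j. of_int d2 * (of_int p2 * cyc_unit n j + of_int p3 * cyc_unit n (j + 1)) \<in> circulant_image n a b"
    and per1: "\<And>j. d1 dvd \<phi> (j + n) - \<phi> j"
    and per2: "\<And>j. d2 dvd \<chi> (j + n) - \<chi> j"
  shows "x \<in> circulant_image n a b \<longleftrightarrow>
    d1 dvd (\<Sum>u<n. \<phi> u * x u) \<and> d2 dvd (\<Sum>u<n. \<chi> u * x u)"
proof -
  define H where "H = circulant_image n a b"
  interpret int_submodule H
    unfolding H_def by (rule int_submodule_circulant)
  let ?e = "cyc_unit n"
  have inv1: "d1 dvd b * b' - 1" and inv2: "d2 dvd b * b' - 1"
    using inv by (auto dest: dvd_mult_left dvd_mult_right)
  \<comment> \<open>Cramer's rule: the determinant is 1, so eliminating \<open>?e (j + 1)\<close>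
    from the two relations leaves exactly \<open>d1 * d2\<close> times \<open>?e j\<close>.\<close>
  have kill: "of_int (d1 * d2) * ?e j \<in> H" for j
  proof -
    have "of_int (d2 * p3) * (of_int d1 * (of_int p0 * ?e j + of_int p1 * ?e (j + 1)))
      + of_int (- (d1 * p1)) * (of_int d2 * (of_int p2 * ?e j + of_int p3 * ?e (j + 1))) \<in> H" (is "?lhs \<in> _")
      using rel1 rel2 unfolding H_def[symmetric] by (rule comb_mem)
    also have "?lhs = of_int (d1 * d2 * (p0 * p3 - p1 * p2)) * ?e j"
      by (simp add: algebra_simps)
    finally show ?thesis
      by (simp only: det mult_1_right)
  qed
  obtain k where k: "b * b' = 1 + d1 * d2 * k"
    using inv by (metis add.commute diff_add_cancel dvdE)
  \<comment> \<open>Multiplying by \<open>b'\<close> makes the recurrence monic; the excess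
    \<open>d1 * d2 * k\<close> of \<open>b * b'\<close> over 1 is removed by
    \<open>kill\<close>.\<close>
  have step: "?e (j + 2) - of_int (a * b') * ?e (j + 1) + ?e j \<in> H" for j
  proof -
    have "of_int b * ?e j - of_int a * ?e (j + 1) + of_int b * ?e (j + 2) \<in> H"
      unfolding H_def by (rule cyc_unit_recurrence)
    then have "of_int b' * (of_int b * ?e j - of_int a * ?e (j + 1) + of_int b * ?e (j + 2))
      - of_int k * (of_int (d1 * d2) * ?e (j + 2) + of_int (d1 * d2) * ?e j) \<in> H" (is "?lhs \<in> _")
      by (rule diff_mem[OF scale_mem scale_mem[OF add_mem[OF kill kill]]])
    also have "?lhs = of_int (b * b' - d1 * d2 * k) * ?e (j + 2) - of_int (a * b') * ?e (j + 1)
        + of_int (b * b' - d1 * d2 * k) * ?e j"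
      by (simp add: algebra_simps)
    also have "b * b' - d1 * d2 * k = 1"
      using k by simp
    finally show ?thesis
      by (simp only: of_int_1 mult_1_left)
  qed
  define f0 where "f0 = of_int p0 * ?e 0 + of_int p1 * ?e 1"
  define f1 where "f1 = of_int p2 * ?e 0 + of_int p3 * ?e 1"
  \<comment> \<open>The initial values of \<open>\<phi>\<close> and \<open>\<chi>\<close> are the
    entries of the inverse of the matrix defining \<open>f0\<close> and \<open>f1\<close>, which
    settles \<open>j = 0\<close> and \<open>j = 1\<close>. From \<open>rec_seq.induct\<close> only
    the two-step induction is taken.\<close>
  have span: "?e j - (of_int (\<phi> j) * f0 + of_int (\<chi> j) * f1) \<in> H" for j
  proof (induction j rule: rec_seq.induct[where P = "\<lambda>_ _ _ j. ?e j - (of_int (\<phi> j) * f0 + of_int (\<chi> j) * f1) \<in> H" for j])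
    case (1 c x y)
    have "of_int (\<phi> 0) * f0 + of_int (\<chi> 0) * f1 = of_int (p0 * p3 - p1 * p2) * ?e 0"
      by (simp add: f0_def f1_def \<phi>_def \<chi>_def algebra_simps)
    then show ?case
      using det by (simp add: zero_mem)
  next
    case (2 c x y)
    have "of_int (\<phi> 1) * f0 + of_int (\<chi> 1) * f1 = of_int (p0 * p3 - p1 * p2) * ?e 1"
      by (simp add: f0_def f1_def \<phi>_def \<chi>_def algebra_simps)
    then show ?case
      using det by (simp add: zero_mem)
  next
    case (3 c x y j)
    let ?X = "\<lambda>j. ?e j - (of_int (\<phi> j) * f0 + of_int (\<chi> j) * f1)"
    have "(?e (j + 2) - of_int (a * b') * ?e (j + 1) + ?e j) + of_int (a * b') * ?X (Suc j) - ?X j \<in> H" (is "?lhs \<in> _")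
      by (rule diff_mem[OF add_mem[OF step scale_mem[OF 3(1)]] 3(2)])
    also have "?lhs = ?X (Suc (Suc j))"
      by (simp add: \<phi>_def \<chi>_def algebra_simps)
    finally show ?case .
  qed
  show ?thesis
  proof
    assume "x \<in> circulant_image n a b"
    then show "d1 dvd (\<Sum>u<n. \<phi> u * x u) \<and> d2 dvd (\<Sum>u<n. \<chi> u * x u)"
      using circulant_functional per1 per2 rec_seq_mod_recurrence[OF inv1] rec_seq_mod_recurrence[OF inv2]
      unfolding \<phi>_def \<chi>_def by blast
  next
    assume "d1 dvd (\<Sum>u<n. \<phi> u * x u) \<and> d2 dvd (\<Sum>u<n. \<chi> u * x u)"
    then obtain k1 k2 where k: "(\<Sum>u<n. \<phi> u * x u) = d1 * k1" "(\<Sum>u<n. \<chi> u * x u) = d2 * k2"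
      by (auto elim!: dvdE)
    \<comment> \<open>By \<open>span\<close>, \<open>x\<close> is congruent to the two sums times
      \<open>f0\<close> and \<open>f1\<close>; these are multiples of \<open>d1 * f0\<close> and
      \<open>d2 * f1\<close>, which lie in \<open>H\<close>.\<close>
    have "(\<Sum>u<n. of_int (x u) * ?e u) =
      (\<Sum>u<n. of_int (x u) * (?e u - (of_int (\<phi> u) * f0 + of_int (\<chi> u) * f1)))
      + (of_int (\<Sum>u<n. \<phi> u * x u) * f0 + of_int (\<Sum>u<n. \<chi> u * x u) * f1)"
      unfolding of_int_sum sum_distrib_right sum.distrib[symmetric]
      by (intro sum.cong) (simp_all add: algebra_simps)
    also have "of_int (\<Sum>u<n. \<phi> u * x u) * f0 = of_int k1 * (of_int d1 * f0)"
      by (simp only: k of_int_mult mult_ac)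
    also have "of_int (\<Sum>u<n. \<chi> u * x u) * f1 = of_int k2 * (of_int d2 * f1)"
      by (simp only: k of_int_mult mult_ac)
    also have "(\<Sum>u<n. of_int (x u) * (?e u - (of_int (\<phi> u) * f0 + of_int (\<chi> u) * f1)))
      + (of_int k1 * (of_int d1 * f0) + of_int k2 * (of_int d2 * f1)) \<in> H"
      by (rule add_mem[OF sum_mem[OF scale_mem[OF span]] comb_mem])
        (use rel1[of 0] rel2[of 0] in \<open>simp_all add: H_def f0_def f1_def\<close>)
    finally show "x \<in> circulant_image n a b"
      unfolding H_def by (rule circulant_image_cong) (rule cyc_unit_expansion)
  qed
qed

section \<open>Coprimality to \<open>b\<close>, shift relations and periods\<close>

lemma coprime_add_multiple: "coprime (x + b * y) b \<longleftrightarrow> coprime x b" for x b y :: int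
  by (metis add.commute coprime_commute coprime_iff_gcd_eq_1 gcd_add_mult mult.commute)

text \<open>Modulo \<open>b\<close> the recurrence is multiplication by \<open>a\<close>, so
  \<open>lucas a b k\<close> is congruent to \<open>a ^ k\<close>.\<close>

lemma coprime_lucas:
  assumes "coprime a b"
  shows "coprime (lucas a b k) b"
  using assms
proof (induction a b k rule: lucas.induct)
  case (3 a b k)
  have "lucas a b (Suc (Suc k)) = a * lucas a b (Suc k) + b * (- b * lucas a b k)"
    by (simp add: power2_eq_square)
  then show ?case
    using 3 by (simp only: coprime_add_multiple) simp
qed simp_all

lemma obtain_inverse_mod:
  assumes "coprime d (b::int)"
  obtains b' where "d dvd b * b' - 1"
proof -
  obtain u v where "u * d + v * b = 1"
    using assms bezout_int[of d b] by auto
  then have "b * v - 1 = d * (- u)"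
    by (simp add: algebra_simps)
  then show thesis
    using that[of v] by simp
qed

text \<open>The first difference vanishes by periodicity. Starting at \<open>j + (n - 1) * h\<close>
  turns the offset \<open>h\<close> into \<open>n * h\<close>, a multiple of the period.\<close>

lemma cyc_unit_shift_relation:
  assumes "n > 0"
    and "\<And>j. of_int B * (cyc_unit n (j + n) - cyc_unit n j)
      - of_int T * (cyc_unit n (j + h + \<sigma>) - cyc_unit n (j + h)) \<in> circulant_image n a b"
  shows "of_int T * (cyc_unit n (j + \<sigma>) - cyc_unit n j) \<in> circulant_image n a b"
proof -
  interpret int_submodule "circulant_image n a b"
    by (rule int_submodule_circulant)
  let ?i = "j + (n - 1) * h"
  have *: "?i + h = j + n * h" "j + n * h + \<sigma> = j + \<sigma> + n * h"
    using assms(1) by (cases n; simp)+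
  have "of_int (-1) * (of_int B * (cyc_unit n (?i + n) - cyc_unit n ?i)
      - of_int T * (cyc_unit n (?i + h + \<sigma>) - cyc_unit n (?i + h))) \<in> circulant_image n a b"
    by (rule scale_mem[OF assms(2)])
  then show ?thesis
    by (simp only: cyc_unit_add(1) * cyc_unit_add(2)) simp
qed

text \<open>The difference between a solution and its shift obeys the same linear recurrence, so two
  initial values decide.\<close>

lemma rec_seq_shift_dvd:
  assumes "E dvd rec_seq c x y \<sigma> - x" "E dvd rec_seq c x y (\<sigma> + 1) - y"
  shows "E dvd rec_seq c x y (j + \<sigma>) - rec_seq c x y j"
proof (induction j rule: less_induct)
  case (less j)
  consider "j = 0" | "j = 1" | i where "j = Suc (Suc i)"
    by (metis One_nat_def not0_implies_Suc)
  then show ?case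
  proof cases
    case 3
    have "E dvd c * (rec_seq c x y (Suc i + \<sigma>) - rec_seq c x y (Suc i))
        - (rec_seq c x y (i + \<sigma>) - rec_seq c x y i)"
      by (intro dvd_diff dvd_mult less) (use 3 in auto)
    then show ?thesis
      using 3 by (simp add: algebra_simps)
  qed (use assms in simp_all)
qed

text \<open>Lifts the short period \<open>\<sigma>\<close> modulo \<open>E\<close> to the period
  \<open>n\<close> modulo \<open>T * E\<close>: the factor \<open>T\<close> supplies the rest, and
  \<open>b ^ N\<close> cancels.\<close>

lemma period_dvd:
  fixes \<phi> :: "nat \<Rightarrow> int"
  assumes "T * E dvd b ^ N * (\<phi> (j + n) - \<phi> j) - T * (\<phi> (j + h + \<sigma>) - \<phi> (j + h))"
    and "E dvd \<phi> (j + h + \<sigma>) - \<phi> (j + h)" and "coprime (T * E) b"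
  shows "T * E dvd \<phi> (j + n) - \<phi> j"
proof -
  have "T * E dvd T * (\<phi> (j + h + \<sigma>) - \<phi> (j + h))"
    using assms(2) by (rule mult_dvd_mono[OF dvd_refl])
  then have "T * E dvd b ^ N * (\<phi> (j + n) - \<phi> j)"
    using assms(1) by (metis diff_add_cancel dvd_add)
  moreover have "coprime (T * E) (b ^ N)"
    using assms(3) by simp
  ultimately show ?thesis
    by (simp add: coprime_dvd_mult_right_iff)
qed

text \<open>After multiplication by \<open>T\<close> all unit vectors agree modulo the image, so
  \<open>T\<close> times the recurrence collapses to \<open>T * (a - 2 * b)\<close> times a single
  one. The new generators are \<open>e_1 - e_0\<close> and \<open>- e_0\<close>.\<close>

lemma circulant_cokernel_odd:
  fixes a b :: int and q :: nat
  defines "n \<equiv> 2 * q + 3" and "T \<equiv> lucas a b (q + 1) + b * lucas a b q"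
  assumes "coprime a b"
  shows "\<exists>\<phi> \<chi>. \<phi> 0 * \<chi> 1 - \<phi> 1 * \<chi> 0 = 1 \<and>
    (\<forall>x. x \<in> circulant_image n a b \<longleftrightarrow>
      T dvd (\<Sum>u<n. \<phi> u * x u) \<and> T * (a - 2 * b) dvd (\<Sum>u<n. \<chi> u * x u))"
proof -
  define E where "E = a - 2 * b"
  have copT: "coprime T b"
    unfolding T_def coprime_add_multiple using assms by (intro coprime_lucas)
  have copE: "coprime E b"
    using assms coprime_add_multiple[of a b "-2"] by (simp add: E_def mult.commute)
  \<comment> \<open>The modulus is \<open>d1 * d2\<close> of \<open>circulant_cokernel\<close>. It
    is 0 if \<open>E = 0\<close>; coprimality then makes \<open>b\<close> a unit.\<close>
  have "coprime (T * (T * E)) b"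
    using copT copE by simp
  then obtain b' where b': "T * (T * E) dvd b * b' - 1"
    by (rule obtain_inverse_mod)
  have E_inv: "E dvd b * b' - 1"
    using b' by (auto dest: dvd_mult_right)
  have bT: "T dvd b * b' - 1" "T * E dvd b * b' - 1"
    using b' by (auto dest: dvd_mult_right dvd_mult_left)
  interpret int_submodule "circulant_image n a b"
    by (rule int_submodule_circulant)
  let ?e = "cyc_unit n"
  let ?H = "circulant_image n a b"
  have shift: "of_int T * (?e (j + 1) - ?e j) \<in> ?H" for j
  proof (rule cyc_unit_shift_relation)
    show "of_int (b ^ (q + 1)) * (?e (j + n) - ?e j) - of_int T * (?e (j + (q + 1) + 1) - ?e (j + (q + 1))) \<in> ?H" for j
      using odd_period[of b ?e a q j, OF cyc_unit_recurrence] by (simp only: n_def T_def)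
  qed (simp add: n_def)
  \<comment> \<open>\<open>odd_period\<close> again, now for integers modulo \<open>T * F\<close>.
    \<open>F\<close> is 1 for the first dual solution and \<open>E\<close> for the second.\<close>
  have per: "T * F dvd rec_seq (a * b') x y (j + n) - rec_seq (a * b') x y j"
    if "T * F dvd b * b' - 1" "coprime F b"
      "F dvd rec_seq (a * b') x y 1 - x" "F dvd rec_seq (a * b') x y (1 + 1) - y" for F x y j
  proof (rule period_dvd)
    interpret M: int_submodule "{z. T * F dvd z}"
      by (rule int_submodule_multiples)
    show "T * F dvd b ^ (q + 1) * (rec_seq (a * b') x y (j + n) - rec_seq (a * b') x y j)
      - T * (rec_seq (a * b') x y (j + (q + 1) + 1) - rec_seq (a * b') x y (j + (q + 1)))"
      using M.odd_period[of b "rec_seq (a * b') x y" a q j] rec_seq_mod_recurrence[OF that(1)]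
      unfolding n_def T_def by (simp only: of_int_eq_id id_apply mem_Collect_eq)
    show "F dvd rec_seq (a * b') x y (j + (q + 1) + 1) - rec_seq (a * b') x y (j + (q + 1))"
      using that(3,4) by (rule rec_seq_shift_dvd)
    show "coprime (T * F) b"
      using copT that by simp
  qed
  have main: "x \<in> ?H \<longleftrightarrow> T dvd (\<Sum>u<n. rec_seq (a * b') 0 (- (- 1)) u * x u) \<and>
    T * E dvd (\<Sum>u<n. rec_seq (a * b') (- 1) (- 1) u * x u)" for x
  proof (rule circulant_cokernel)
    show "of_int T * (of_int (- 1) * ?e j + of_int 1 * ?e (j + 1)) \<in> ?H" for j
      using shift[of j] by (simp add: algebra_simps)
    show "of_int (T * E) * (of_int (- 1) * ?e j + of_int 0 * ?e (j + 1)) \<in> ?H" for j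
    proof -
      \<comment> \<open>This index replaces \<open>j - 1\<close>, so that the recurrence is centred
        at \<open>j\<close>.\<close>
      let ?i = "j + n - 1"
      have i: "?i + 1 = j + n" "?i + 2 = j + 1 + n"
        by (simp_all add: n_def)
      have "of_int T * (of_int b * ?e ?i - of_int a * ?e (?i + 1) + of_int b * ?e (?i + 2))
        + (of_int b * (of_int T * (?e (?i + 1) - ?e ?i)) + of_int (- b) * (of_int T * (?e (j + 1) - ?e j))) \<in> ?H"
        by (rule add_mem[OF scale_mem[OF cyc_unit_recurrence] comb_mem[OF shift shift]])
      then show ?thesis
        unfolding i cyc_unit_add(1) by (simp add: E_def algebra_simps)
    qed
    show "T dvd rec_seq (a * b') 0 (- (- 1)) (j + n) - rec_seq (a * b') 0 (- (- 1)) j" for j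
      using per[of 1 0 "- (- 1)" j] bT by simp
    \<comment> \<open>Modulo \<open>E\<close>, \<open>a\<close> is \<open>2 * b\<close> and hence
      \<open>a * b'\<close> is 2, so the constant sequence \<open>- 1\<close> solves the
      recurrence.\<close>
    have "E dvd 2 - a * b'"
    proof -
      have "E dvd - E - a * (b * b' - 1)"
        by (rule dvd_diff[OF _ dvd_mult[OF E_inv]]) simp
      also have "\<dots> = b * (2 - a * b')"
        by (simp add: E_def algebra_simps)
      finally show ?thesis
        using copE by (simp add: coprime_dvd_mult_right_iff)
    qed
    then show "T * E dvd rec_seq (a * b') (- 1) (- 1) (j + n) - rec_seq (a * b') (- 1) (- 1) j" for j
      using bT copE by (intro per) (simp_all add: algebra_simps)
  qed (use b' in simp_all)
  show ?thesis
    by (rule exI[of _ "rec_seq (a * b') 0 (- (- 1))"], rule exI[of _ "rec_seq (a * b') (- 1) (- 1)"])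
      (use main in \<open>simp add: E_def\<close>)
qed

text \<open>The relations at \<open>j\<close> have the rows \<open>T (-a, 2b)\<close> and \<open>T (-2b, a)\<close>; here \<open>g\<close> is the greatest
  common divisor of their entries up to the factor \<open>T\<close>, and \<open>u\<close>, \<open>v\<close> complete \<open>(-a, 2b) / g\<close> to a
  unimodular matrix.\<close>

lemma circulant_cokernel_even:
  fixes a b g a1 b1 u v :: int and q :: nat
  defines "n \<equiv> 2 * q + 2" and "T \<equiv> lucas a b q"
  assumes "coprime a b" and g: "a = g * a1" "2 * b = g * b1" "g dvd 2" and uv: "u * a1 + v * b1 = 1"
  shows "\<exists>\<phi> \<chi>. \<phi> 0 * \<chi> 1 - \<phi> 1 * \<chi> 0 = 1 \<and>
    (\<forall>x. x \<in> circulant_image n a b \<longleftrightarrow>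
      T * g dvd (\<Sum>u<n. \<phi> u * x u) \<and> T * (g * (a1\<^sup>2 - b1\<^sup>2)) dvd (\<Sum>u<n. \<chi> u * x u))"
proof -
  define E where "E = g * (a1\<^sup>2 - b1\<^sup>2)"
  have E_eq: "E = a1 * a - b1 * (2 * b)"
    unfolding E_def using g(1,2) by algebra
  have copT: "coprime T b"
    unfolding T_def using assms by (intro coprime_lucas)
  have copg: "coprime g b"
    using assms(3) g(1) by simp
  have "g * E = a * a + b * (- 4 * b)"
    unfolding E_eq using g by algebra
  then have "coprime (g * E) b"
    using assms(3) by (simp only: coprime_add_multiple) simp
  then have copE: "coprime E b"
    by simp
  have "coprime (T * g * (T * E)) b"
    using copT copE copg by simp
  then obtain b' where b': "T * g * (T * E) dvd b * b' - 1"
    by (rule obtain_inverse_mod)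
  have bT: "T * g dvd b * b' - 1" "T * E dvd b * b' - 1" 
    using b' by (auto dest: dvd_mult_right dvd_mult_left)
  then have E_inv: "E dvd b * b' - 1"
    by (auto dest: dvd_mult_right)
  interpret int_submodule "circulant_image n a b"
    by (rule int_submodule_circulant)
  let ?e = "cyc_unit n"
  let ?H = "circulant_image n a b"
  have shift: "of_int T * (?e (j + 2) - ?e j) \<in> ?H" for j
  proof (rule cyc_unit_shift_relation)
    show "of_int (b ^ q) * (?e (j + n) - ?e j) - of_int T * (?e (j + q + 2) - ?e (j + q)) \<in> ?H" for j
      using even_period[of b ?e a q j, OF cyc_unit_recurrence] by (simp only: n_def T_def)
  qed (simp add: n_def)
  have per: "T * F dvd rec_seq (a * b') x y (j + n) - rec_seq (a * b') x y j"
    if "T * F dvd b * b' - 1" "coprime F b"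
      "F dvd rec_seq (a * b') x y 2 - x" "F dvd rec_seq (a * b') x y (2 + 1) - y" for F x y j
  proof (rule period_dvd)
    interpret M: int_submodule "{z. T * F dvd z}"
      by (rule int_submodule_multiples)
    show "T * F dvd b ^ q * (rec_seq (a * b') x y (j + n) - rec_seq (a * b') x y j)
      - T * (rec_seq (a * b') x y (j + q + 2) - rec_seq (a * b') x y (j + q))"
      using M.even_period[of b "rec_seq (a * b') x y" a q j] rec_seq_mod_recurrence[OF that(1)]
      unfolding n_def T_def by (simp only: of_int_eq_id id_apply mem_Collect_eq)
    show "F dvd rec_seq (a * b') x y (j + q + 2) - rec_seq (a * b') x y (j + q)"
      using that(3,4) by (rule rec_seq_shift_dvd)
    show "coprime (T * F) b"
      using copT that by simp
  qed
  have rel1: "of_int (T * g) * (of_int (- a1) * ?e j + of_int b1 * ?e (j + 1)) \<in> ?H" for j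
  proof -
    let ?i = "j + n - 1"
    have i: "?i + 1 = j + n" "?i + 2 = j + 1 + n"
      by (simp_all add: n_def)
    have "of_int T * (of_int b * ?e ?i - of_int a * ?e (?i + 1) + of_int b * ?e (?i + 2))
      + of_int b * (of_int T * (?e (?i + 2) - ?e ?i)) \<in> ?H"
      by (rule add_mem[OF scale_mem[OF cyc_unit_recurrence] scale_mem[OF shift]])
    also have "of_int T * (of_int b * ?e ?i - of_int a * ?e (?i + 1) + of_int b * ?e (?i + 2))
      + of_int b * (of_int T * (?e (?i + 2) - ?e ?i))
      = of_int T * (of_int (2 * b) * ?e (j + 1) - of_int a * ?e j)" (is "_ = ?r1")
      unfolding i cyc_unit_add(1) by (simp add: algebra_simps)
    also have "\<dots> = of_int (T * g) * (of_int (- a1) * ?e j + of_int b1 * ?e (j + 1))"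
      unfolding g(1,2) by (simp add: algebra_simps)
    finally show ?thesis .
  qed
  have row2: "of_int (T * g) * (of_int a1 * ?e (j + 1) - of_int b1 * ?e j) \<in> ?H" for j
  proof -
    have "of_int b * (of_int T * (?e (j + 2) - ?e j))
      + of_int (- T) * (of_int b * ?e j - of_int a * ?e (j + 1) + of_int b * ?e (j + 2)) \<in> ?H"
      by (rule comb_mem[OF shift cyc_unit_recurrence])
    also have "of_int b * (of_int T * (?e (j + 2) - ?e j))
      + of_int (- T) * (of_int b * ?e j - of_int a * ?e (j + 1) + of_int b * ?e (j + 2))
      = of_int T * (of_int a * ?e (j + 1) - of_int (2 * b) * ?e j)" (is "_ = ?r1")
      by (simp add: algebra_simps)
    also have "\<dots> = of_int (T * g) * (of_int a1 * ?e (j + 1) - of_int b1 * ?e j)"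
      unfolding g(1,2) by (simp add: algebra_simps)
    finally show ?thesis .
  qed
  \<comment> \<open>The row \<open>(- a1, b1)\<close> is completed by \<open>(- v, - u)\<close>; by
    \<open>uv\<close> the determinant is 1.\<close>
  have main: "x \<in> ?H \<longleftrightarrow> T * g dvd (\<Sum>i<n. rec_seq (a * b') (- u) (- (- v)) i * x i) \<and>
    T * E dvd (\<Sum>i<n. rec_seq (a * b') (- b1) (- a1) i * x i)" for x
  proof (rule circulant_cokernel)
    show "- a1 * - u - b1 * - v = 1"
      using uv by (simp add: algebra_simps)
    show "of_int (T * g) * (of_int (- a1) * ?e j + of_int b1 * ?e (j + 1)) \<in> ?H" for j
      by (rule rel1)
    show "of_int (T * E) * (of_int (- v) * ?e j + of_int (- u) * ?e (j + 1)) \<in> ?H" for j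
    proof -
      \<comment> \<open>The multiplier \<open>b1 * u + a1 * v\<close> is chosen so that, by
        \<open>uv\<close>, the coefficients become \<open>T * E\<close> times \<open>- v\<close> and
        \<open>- u\<close>.\<close>
      have "of_int (b1 * u + a1 * v) * (of_int (T * g) * (of_int (- a1) * ?e j + of_int b1 * ?e (j + 1)))
        + of_int (- 1) * (of_int (T * g) * (of_int a1 * ?e (j + 1) - of_int b1 * ?e j)) \<in> ?H"
        by (rule comb_mem[OF rel1 row2])
      also have "of_int (b1 * u + a1 * v) * (of_int (T * g) * (of_int (- a1) * ?e j + of_int b1 * ?e (j + 1)))
        + of_int (- 1) * (of_int (T * g) * (of_int a1 * ?e (j + 1) - of_int b1 * ?e j))
        = of_int (T * g * (b1 - a1 * (b1 * u + a1 * v))) * ?e j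
          + of_int (T * g * (b1 * (b1 * u + a1 * v) - a1)) * ?e (j + 1)"
        by (simp add: algebra_simps)
      also have "T * g * (b1 - a1 * (b1 * u + a1 * v)) = T * E * - v"
        unfolding E_def using uv by algebra
      also have "T * g * (b1 * (b1 * u + a1 * v) - a1) = T * E * - u"
        unfolding E_def using uv by algebra
      finally show ?thesis
        by (simp only: of_int_mult distrib_left mult.assoc)
    qed
    \<comment> \<open>Modulo \<open>g\<close> both \<open>a * b'\<close> and 2 vanish, so every
      solution changes sign after two steps and thus has period 2.\<close>
    have "g dvd a * b'" "g dvd 2"
      using g by simp_all
    then show "T * g dvd rec_seq (a * b') (- u) (- (- v)) (j + n) - rec_seq (a * b') (- u) (- (- v)) j" for j
      using bT copg by (intro per) (simp_all add: numeral_eq_Suc)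
    \<comment> \<open>This divisibility and the next say that \<open>- b1\<close> and
      \<open>- a1\<close> alternate in the second dual solution modulo \<open>E\<close>. Both are
      shown after multiplication by \<open>b\<close>, which is coprime to \<open>E\<close>.\<close>
    have "E dvd 2 * b1 - a * b' * a1"
    proof -
      have "E dvd - E - a1 * a * (b * b' - 1)"
        by (rule dvd_diff[OF _ dvd_mult[OF E_inv]]) simp
      also have "\<dots> = b * (2 * b1 - a * b' * a1)"
        by (simp add: E_eq algebra_simps)
      finally show ?thesis
        using copE by (simp add: coprime_dvd_mult_right_iff)
    qed
    moreover have "E dvd 2 * a1 - a * b' * b1"
    proof -
      have "E dvd - a * b1 * (b * b' - 1)"
        using E_inv by (rule dvd_mult)
      also have "\<dots> = b * (2 * a1 - a * b' * b1)"
        using g by algebra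
      finally show ?thesis
        using copE by (simp add: coprime_dvd_mult_right_iff)
    qed
    ultimately have "E dvd 2 * b1 - a * b' * a1" "E dvd a * b' * (2 * b1 - a * b' * a1) + (2 * a1 - a * b' * b1)"
      by auto
    then show "T * E dvd rec_seq (a * b') (- b1) (- a1) (j + n) - rec_seq (a * b') (- b1) (- a1) j" for j
      using bT copE by (intro per) (simp_all add: numeral_eq_Suc algebra_simps)
  qed (use b' in simp_all)
  show ?thesis
    by (rule exI[of _ "rec_seq (a * b') (- u) (- (- v))"], rule exI[of _ "rec_seq (a * b') (- b1) (- a1)"])
      (use main uv in \<open>simp add: E_def algebra_simps\<close>)
qed

section \<open>Quotients of free abelian groups\<close>

lemma Zmod_carrier: "z \<in> carrier (Zmod d) \<longleftrightarrow> z mod \<bar>d\<bar> = z"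
  by (cases "d = 0")
    (auto simp: Zmod_def carrier_integer_mod_group intro: mod_pos_pos_trivial,
      metis pos_mod_sign zero_less_abs_iff, metis pos_mod_bound zero_less_abs_iff)

lemma Zmod_group [simp]: "group (Zmod d)"
  by (simp add: Zmod_def)

lemma Zmod_mult: "z \<otimes>\<^bsub>Zmod d\<^esub> w = (z + w) mod \<bar>d\<bar>"
  by (simp add: Zmod_def)

lemma Zmod_one: "\<one>\<^bsub>Zmod d\<^esub> = 0"
  by (simp add: Zmod_def)

lemma sum_split_two: "(\<Sum>u<k + 2. f u) = f 0 + f 1 + (\<Sum>i<k. f (i + 2))"
  for f :: "nat \<Rightarrow> 'a::comm_monoid_add"
  unfolding add_2_eq_Suc' sum.lessThan_Suc_shift by (simp add: add.assoc)

text \<open>First isomorphism theorem for the map given by the coordinates from 2 on and the two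
  functionals. It is onto because, once the later coordinates are fixed, the first two solve a
  linear system of determinant 1.\<close>

lemma integer_product_quotient:
  fixes k :: nat and r d1 d2 :: int and \<phi> \<chi> :: "nat \<Rightarrow> int"
  defines "G \<equiv> product_group (Some ` {..<k + 2}) (\<lambda>_. integer_group)"
  assumes det: "\<phi> 0 * \<chi> 1 - \<phi> 1 * \<chi> 0 = 1"
  shows "G Mod {x \<in> carrier G. (\<forall>i<k. r dvd x (Some (i + 2))) \<and>
      r * d1 dvd (\<Sum>u<k + 2. \<phi> u * x (Some u)) \<and> r * d2 dvd (\<Sum>u<k + 2. \<chi> u * x (Some u))}
    \<cong> product_group {..<k} (\<lambda>_. Zmod r) \<times>\<times> Zmod (r * d1) \<times>\<times> Zmod (r * d2)" (is "G Mod ?N \<cong> ?K")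
proof -
  define \<Phi> where "\<Phi> \<psi> x = (\<Sum>u<k + 2. \<psi> u * x (Some u))" for \<psi> :: "nat \<Rightarrow> int" and x :: "nat option \<Rightarrow> int"
  define h where "h x = (\<lambda>i\<in>{..<k}. x (Some (i + 2)) mod \<bar>r\<bar>, \<Phi> \<phi> x mod \<bar>r * d1\<bar>, \<Phi> \<chi> x mod \<bar>r * d2\<bar>)"
    for x :: "nat option \<Rightarrow> int"
  have \<Phi>_mult: "\<Phi> \<psi> (x \<otimes>\<^bsub>G\<^esub> y) = \<Phi> \<psi> x + \<Phi> \<psi> y" for \<psi> x y
    by (auto simp: \<Phi>_def G_def sum.distrib[symmetric] distrib_left intro!: sum.cong)
  have "h \<in> hom G ?K"
  proof (rule homI)
    show "h x \<in> carrier ?K" for x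
      by (auto simp: h_def Zmod_carrier)
    show "h (x \<otimes>\<^bsub>G\<^esub> y) = h x \<otimes>\<^bsub>?K\<^esub> h y" for x y
      unfolding h_def \<Phi>_mult mult_DirProd Zmod_mult
      by (auto simp: G_def Zmod_mult mod_add_eq image_iff)
  qed
  moreover have "group G"
    by (simp add: G_def)
  moreover have "group ?K"
    by (intro DirProd_group product_group) simp_all
  ultimately interpret group_hom G ?K h
    by (simp add: group_hom_def group_hom_axioms_def)
  have "kernel G ?K h = ?N"
    by (auto simp: kernel_def h_def \<Phi>_def Zmod_one restrict_def fun_eq_iff dvd_eq_mod_eq_0[symmetric] split: if_splits)
  moreover have "h ` carrier G = carrier ?K"
  proof
    show "h ` carrier G \<subseteq> carrier ?K"
      by (intro image_subsetI hom_closed)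
    show "carrier ?K \<subseteq> h ` carrier G"
    proof
      fix z
      assume "z \<in> carrier ?K"
      then obtain f z1 z2 where z: "z = (f, z1, z2)" "f \<in> (\<Pi>\<^sub>E i\<in>{..<k}. carrier (Zmod r))"
        "z1 mod \<bar>r * d1\<bar> = z1" "z2 mod \<bar>r * d2\<bar> = z2"
        by (auto simp: Zmod_carrier)
      \<comment> \<open>\<open>A\<close> and \<open>B\<close> are what coordinates 0 and 1 must
        still contribute; \<open>y 0\<close> and \<open>y 1\<close> then follow by Cramer's
        rule.\<close>
      define A where "A = z1 - (\<Sum>i<k. \<phi> (i + 2) * f i)"
      define B where "B = z2 - (\<Sum>i<k. \<chi> (i + 2) * f i)"
      define y where "y u = (if u = 0 then \<chi> 1 * A - \<phi> 1 * B else if u = 1 then \<phi> 0 * B - \<chi> 0 * A else f (u - 2))"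
        for u :: nat
      define x where "x = (\<lambda>w\<in>Some ` {..<k + 2}. y (the w))"
      have "\<phi> 0 * y 0 + \<phi> 1 * y 1 = (\<phi> 0 * \<chi> 1 - \<phi> 1 * \<chi> 0) * A"
        "\<chi> 0 * y 0 + \<chi> 1 * y 1 = (\<phi> 0 * \<chi> 1 - \<phi> 1 * \<chi> 0) * B"
        by (simp_all add: y_def algebra_simps)
      then have y01: "\<phi> 0 * y 0 + \<phi> 1 * y 1 = A" "\<chi> 0 * y 0 + \<chi> 1 * y 1 = B"
        using det by simp_all
      have \<Phi>_x: "\<Phi> \<psi> x = \<psi> 0 * y 0 + \<psi> 1 * y 1 + (\<Sum>i<k. \<psi> (i + 2) * f i)" for \<psi>
      proof -
        have "\<Phi> \<psi> x = (\<Sum>u<k + 2. \<psi> u * y u)"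
          unfolding \<Phi>_def x_def by (intro sum.cong) auto
        also have "\<dots> = \<psi> 0 * y 0 + \<psi> 1 * y 1 + (\<Sum>i<k. \<psi> (i + 2) * y (i + 2))"
          by (rule sum_split_two)
        finally show ?thesis
          by (simp add: y_def)
      qed
      have "x \<in> carrier G"
        by (auto simp: x_def G_def)
      moreover have "f i mod \<bar>r\<bar> = f i" if "i < k" for i
        using z(2) that by (auto simp: Zmod_carrier PiE_iff)
      then have "(\<lambda>i\<in>{..<k}. x (Some (i + 2)) mod \<bar>r\<bar>) = f"
        using z(2) by (auto simp: x_def y_def PiE_iff extensional_def fun_eq_iff)
      then have "h x = z"
        unfolding h_def \<Phi>_x y01 A_def B_def using z by simp
      ultimately show "z \<in> h ` carrier G"
        by blast
    qed
  qed
  ultimately show ?thesis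
    using FactGroup_iso by simp
qed

lemma circulant_image_scale:
  assumes "\<And>u. u < n \<Longrightarrow> z u = r * w u" and "r \<noteq> 0"
  shows "z \<in> circulant_image n (r * a) (r * b) \<longleftrightarrow> w \<in> circulant_image n a b"
proof -
  have "z u = r * a * y u - r * b * y (Suc u mod n) - r * b * y ((u + n - 1) mod n) \<longleftrightarrow>
    w u = a * y u - b * y (Suc u mod n) - b * y ((u + n - 1) mod n)" if "u < n" for u y
  proof -
    have "r * a * y u - r * b * y (Suc u mod n) - r * b * y ((u + n - 1) mod n) =
      r * (a * y u - b * y (Suc u mod n) - b * y ((u + n - 1) mod n))"
      by (simp only: right_diff_distrib mult.assoc)
    then show ?thesis
      using assms(1)[OF that] assms(2) by (metis mult_left_cancel)
  qed
  then show ?thesis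
    unfolding circulant_image_def mem_Collect_eq by meson
qed

lemma circulant_image_multiple:
  assumes "z \<in> circulant_image n (r * a) (r * b)"
  shows "\<exists>w. \<forall>u<n. z u = r * w u"
proof -
  obtain y where y: "\<forall>u<n. z u = r * a * y u - r * b * y (Suc u mod n) - r * b * y ((u + n - 1) mod n)"
    using assms unfolding circulant_image_def by blast
  show ?thesis
    by (rule exI[of _ "\<lambda>u. a * y u - b * y (Suc u mod n) - b * y ((u + n - 1) mod n)"])
      (use y in \<open>simp only: right_diff_distrib mult.assoc\<close>)
qed

text \<open>Scaling the matrix scales its image, so the right-hand side has to force
  \<open>r\<close> to divide every \<open>z u\<close>. For \<open>u \<ge> 2\<close> this is the
  first condition; subtracting these terms from the functionals and inverting the remaining system
  of determinant 1 gives \<open>u = 0\<close> and \<open>u = 1\<close>.\<close>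

lemma circulant_cokernel_scaled:
  fixes k :: nat and a b r d1 d2 :: int and \<phi> \<chi> :: "nat \<Rightarrow> int"
  defines "n \<equiv> k + 2"
  assumes "r > 0" and det: "\<phi> 0 * \<chi> 1 - \<phi> 1 * \<chi> 0 = 1"
    and img: "\<And>x. x \<in> circulant_image n a b \<longleftrightarrow>
        d1 dvd (\<Sum>u<n. \<phi> u * x u) \<and> d2 dvd (\<Sum>u<n. \<chi> u * x u)"
  shows "z \<in> circulant_image n (r * a) (r * b) \<longleftrightarrow> (\<forall>i<k. r dvd z (i + 2)) \<and>
      r * d1 dvd (\<Sum>u<n. \<phi> u * z u) \<and> r * d2 dvd (\<Sum>u<n. \<chi> u * z u)" (is "?L \<longleftrightarrow> ?R")
proof -
  have multiple: "?L \<longleftrightarrow> ?R" if w: "\<And>u. u < n \<Longrightarrow> z u = r * w u" for w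
  proof -
    have "z \<in> circulant_image n (r * a) (r * b) \<longleftrightarrow> w \<in> circulant_image n a b"
      using w \<open>r > 0\<close> by (intro circulant_image_scale) auto
    moreover have "(\<Sum>u<n. \<psi> u * z u) = r * (\<Sum>u<n. \<psi> u * w u)" for \<psi>
      unfolding sum_distrib_left by (intro sum.cong) (simp_all add: w)
    moreover have "\<forall>i<k. r dvd z (i + 2)"
      using w by (simp add: n_def)
    ultimately show ?thesis
      using \<open>r > 0\<close> by (simp add: img)
  qed
  show ?thesis
  proof
    assume ?L
    then obtain w where w: "\<forall>u<n. z u = r * w u"
      using circulant_image_multiple by blast
    show ?R
      by (rule iffD1[OF multiple \<open>?L\<close>]) (rule w[rule_format])
  next
    assume R: ?R
    have tail: "r dvd (\<Sum>i<k. \<psi> (i + 2) * z (i + 2))" for \<psi>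
      using R by (intro dvd_sum dvd_mult) simp
    have "r dvd (\<Sum>u<n. \<phi> u * z u)" "r dvd (\<Sum>u<n. \<chi> u * z u)"
      using R by (auto dest: dvd_mult_left)
    then have head: "r dvd \<phi> 0 * z 0 + \<phi> 1 * z 1" "r dvd \<chi> 0 * z 0 + \<chi> 1 * z 1"
      unfolding n_def sum_split_two using tail by (simp_all only: dvd_add_left_iff)
    have "r dvd \<chi> 1 * (\<phi> 0 * z 0 + \<phi> 1 * z 1) - \<phi> 1 * (\<chi> 0 * z 0 + \<chi> 1 * z 1)"
      "r dvd \<phi> 0 * (\<chi> 0 * z 0 + \<chi> 1 * z 1) - \<chi> 0 * (\<phi> 0 * z 0 + \<phi> 1 * z 1)"
      using head by simp_all
    moreover have "\<chi> 1 * (\<phi> 0 * z 0 + \<phi> 1 * z 1) - \<phi> 1 * (\<chi> 0 * z 0 + \<chi> 1 * z 1) = z 0"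
      using det by algebra
    moreover have "\<phi> 0 * (\<chi> 0 * z 0 + \<chi> 1 * z 1) - \<chi> 0 * (\<phi> 0 * z 0 + \<phi> 1 * z 1) = z 1"
      using det by algebra
    ultimately have z01: "r dvd z 0" "r dvd z 1"
      by simp_all
    have "r dvd z u" if "u < n" for u
    proof -
      consider "u = 0" | "u = 1" | i where "u = i + 2"
        by (metis One_nat_def add_2_eq_Suc' not0_implies_Suc)
      then show ?thesis
        using z01 R that by cases (auto simp: n_def)
    qed
    then show ?L
      by (intro iffD2[OF multiple[of "\<lambda>u. z u div r"] R]) simp
  qed
qed

section \<open>The Laplacian of the cone over a cycle\<close>

lemma pred_mod_eq_iff:
  assumes "u < n" "v < n"
  shows "u = Suc v mod n \<longleftrightarrow> v = (u + n - 1) mod n"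
  using pred_mod_Suc[OF assms(1)] Suc_mod_pred[OF assms(2)] by metis

text \<open>From \<open>n = 3\<close> on, a vertex and its two neighbours are distinct, so that its
  two edges differ as sets.\<close>

lemma Suc_mod_neq:
  assumes "n \<ge> 3" "u < n"
  shows "Suc u mod n \<noteq> u" "(u + n - 1) mod n \<noteq> u" "Suc u mod n \<noteq> (u + n - 1) mod n"
proof -
  have less: "Suc u mod n < n"
    using assms by simp
  show 1: "Suc u mod n \<noteq> u"
    using assms by (cases "Suc u = n") auto
  show "(u + n - 1) mod n \<noteq> u"
    using 1 pred_mod_eq_iff[OF assms(2) assms(2)] by metis
  have "Suc (Suc u mod n) mod n \<noteq> u"
  proof (cases "Suc u = n")
    case False
    then show ?thesis
      using assms by (cases "Suc (Suc u) = n") auto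
  qed (use assms in auto)
  then show "Suc u mod n \<noteq> (u + n - 1) mod n"
    unfolding pred_mod_eq_iff[OF assms(2) less, symmetric] by (rule not_sym)
qed

lemma cycle_edge_eq:
  assumes "n \<ge> 3" "u < n" "v < n"
  shows "{u, v} \<in> (\<lambda>i. {i, (i + 1) mod n}) ` {..<n} \<longleftrightarrow> v = Suc u mod n \<or> v = (u + n - 1) mod n"
proof -
  have "{u, v} \<in> (\<lambda>i. {i, (i + 1) mod n}) ` {..<n} \<longleftrightarrow> v = Suc u mod n \<or> u = Suc v mod n"
    unfolding image_iff doubleton_eq_iff Suc_eq_plus1[symmetric] using assms(2,3) by blast
  then show ?thesis
    unfolding pred_mod_eq_iff[OF assms(2,3)] .
qed

lemma vdegree_cycle:
  assumes "n \<ge> 3" "u < n"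
  shows "vdegree (cycle_graph n) u = 2"
proof -
  define p where "p = (u + n - 1) mod n"
  define w where "w = Suc u mod n"
  define E where "E = (\<lambda>i. {i, (i + 1) mod n}) ` {..<n}"
  have lt: "w < n" "p < n"
    using assms by (simp_all add: p_def w_def)
  have edge: "{u, v} \<in> E \<longleftrightarrow> v = w \<or> v = p" if "v < n" for v
    unfolding E_def p_def w_def using assms that by (rule cycle_edge_eq)
  have "\<exists>v<n. e = {u, v}" if e: "e \<in> E" "u \<in> e" for e
  proof -
    obtain i where i: "i < n" "e = {i, Suc i mod n}"
      using e(1) by (auto simp: E_def)
    show ?thesis
    proof (cases "u = i")
      case True
      then show ?thesis
        using i lt(1) unfolding w_def True by blast
    next
      case False
      then have "e = {u, i}"
        using i(2) e(2) by (simp add: insert_commute)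
      then show ?thesis
        using i(1) by blast
    qed
  qed
  then have "{e \<in> E. u \<in> e} = {{u, w}, {u, p}}"
    using edge lt by fast
  moreover have "w \<noteq> p"
    using Suc_mod_neq[OF assms] by (simp add: p_def w_def)
  then have "{u, w} \<noteq> {u, p}"
    by (simp add: doubleton_eq_iff)
  moreover have "vdegree (cycle_graph n) u = card {e \<in> E. u \<in> e}"
    by (simp add: vdegree_def cycle_graph_def E_def)
  ultimately show ?thesis
    by simp
qed

lemma laplacian_cone_cycle:
  assumes "n \<ge> 3" "u < n" "v < n"
  shows "laplacian (cone m (duplication l (cycle_graph n))) (Some v) (Some u) =
    (if v = u then int m + 2 * int l else 0) - (if v = Suc u mod n then int l else 0)
      - (if v = (u + n - 1) mod n then int l else 0)"
proof -
  define p where "p = (u + n - 1) mod n"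
  define w where "w = Suc u mod n"
  define E where "E = (\<lambda>i. {i, (i + 1) mod n}) ` {..<n}"
  have neq: "w \<noteq> u" "p \<noteq> u" "w \<noteq> p"
    using Suc_mod_neq[OF assms(1,2)] by (simp_all add: p_def w_def)
  have edge: "{u, v} \<in> E \<longleftrightarrow> v = w \<or> v = p"
    unfolding E_def p_def w_def using assms by (rule cycle_edge_eq)
  have "filter_mset P (repeat_mset l M) = repeat_mset l (filter_mset P M)" for P and M :: "nat set multiset"
    by (rule multiset_eqI) simp
  then have deg: "vdegree (duplication l (cycle_graph n)) u = 2 * l"
    using vdegree_cycle[OF assms(1,2)] by (simp add: vdegree_def duplication_def)
  have "edges (duplication l (cycle_graph n)) = repeat_mset l (mset_set E)"
    by (simp add: duplication_def cycle_graph_def E_def)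
  moreover have "finite E"
    by (simp add: E_def)
  ultimately have "count (edges (duplication l (cycle_graph n))) {u, v} = (if v = w \<or> v = p then l else 0)"
    using edge by (simp add: count_mset_set')
  then have adj: "adjacency (duplication l (cycle_graph n)) v u =
      (if v = w then l else 0) + (if v = p then l else 0)"
    using neq by (auto simp: adjacency_def insert_commute)
  have lap: "laplacian (duplication l (cycle_graph n)) v u =
      (if v = u then 2 * int l else 0) - (if v = w then int l else 0) - (if v = p then int l else 0)"
    unfolding laplacian_def adj using deg neq by auto
  have "multigraph (duplication l (cycle_graph n))"
    using simple_graph_cycle_graph[of n] assms by (simp add: multigraph_duplication simple_graph_def)
  then have "laplacian (cone m (duplication l (cycle_graph n))) (Some v) (Some u) =
    laplacian (duplication l (cycle_graph n)) v u + (if v = u then int m else 0)"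
    using assms by (intro laplacian_cone) (simp_all add: duplication_def cycle_graph_def)
  then show ?thesis
    unfolding p_def[symmetric] w_def[symmetric] by (simp add: lap)
qed

lemma sum_three_deltas:
  fixes g :: "nat \<Rightarrow> int"
  assumes "u < n" "w < n" "p < n"
  shows "(\<Sum>v<n. ((if v = u then x else 0) - (if v = w then y else 0) - (if v = p then z else 0)) * g v)
    = x * g u - y * g w - z * g p"
proof -
  have delta: "(\<Sum>v<n. (if v = i then c else 0) * g v) = c * g i" if "i < n" for i c
    using that by (simp add: if_distrib[of "\<lambda>x. x * _"] cong: if_cong)
  show ?thesis
    by (simp only: left_diff_distrib sum_subtractf delta assms)
qed

lemma transpose_image_cone_cycle:
  fixes m l n :: nat
  defines "C \<equiv> cone m (duplication l (cycle_graph n))" and "W \<equiv> Some ` {..<n}"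
  assumes "n \<ge> 3" and x: "x \<in> carrier (product_group W (\<lambda>_. integer_group))"
  shows "x \<in> transpose_image W (laplacian C) \<longleftrightarrow>
    (\<lambda>u. x (Some u)) \<in> circulant_image n (int m + 2 * int l) (int l)"
proof -
  let ?f = "\<lambda>y u. (int m + 2 * int l) * y u - int l * y (Suc u mod n) - int l * y ((u + n - 1) mod n)"
  have sum: "(\<Sum>v\<in>W. laplacian C v (Some u) * y v) = ?f (\<lambda>u. y (Some u)) u" if "u < n" for y u
  proof -
    have "(\<Sum>v\<in>W. laplacian C v (Some u) * y v) = (\<Sum>v<n. laplacian C (Some v) (Some u) * y (Some v))"
      unfolding W_def by (subst sum.reindex) auto
    also have "\<dots> = (\<Sum>v<n. ((if v = u then int m + 2 * int l else 0) - (if v = Suc u mod n then int l else 0)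
      - (if v = (u + n - 1) mod n then int l else 0)) * y (Some v))"
      unfolding C_def by (intro sum.cong refl) (simp only: laplacian_cone_cycle[OF assms(3) that] lessThan_iff)
    also have "\<dots> = ?f (\<lambda>u. y (Some u)) u"
      using that by (intro sum_three_deltas) simp_all
    finally show ?thesis .
  qed
  show ?thesis
  proof
    assume "x \<in> transpose_image W (laplacian C)"
    then obtain y where y: "x = (\<lambda>u\<in>W. \<Sum>v\<in>W. laplacian C v u * y v)"
      unfolding transpose_image_def by blast
    have "x (Some u) = ?f (\<lambda>u. y (Some u)) u" if "u < n" for u
    proof -
      have "Some u \<in> W"
        using that by (simp add: W_def)
      then have "x (Some u) = (\<Sum>v\<in>W. laplacian C v (Some u) * y v)"
        by (simp add: y)
      also have "\<dots> = ?f (\<lambda>u. y (Some u)) u"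
        using that by (rule sum)
      finally show ?thesis .
    qed
    then show "(\<lambda>u. x (Some u)) \<in> circulant_image n (int m + 2 * int l) (int l)"
      unfolding circulant_image_def by (intro CollectI exI[of _ "\<lambda>u. y (Some u)"] allI impI)
  next
    assume "(\<lambda>u. x (Some u)) \<in> circulant_image n (int m + 2 * int l) (int l)"
    then obtain y where y: "\<forall>u<n. x (Some u) = ?f y u"
      unfolding circulant_image_def by blast
    \<comment> \<open>The carrier contains only functions that are \<open>undefined\<close> outside
      \<open>W\<close>, hence the restriction.\<close>
    define z where "z = (\<lambda>w\<in>W. y (the w))"
    have zy: "z (Some u) = y u" if "u < n" for u
      using that by (simp add: z_def W_def)
    have "x w = (\<lambda>u\<in>W. \<Sum>v\<in>W. laplacian C v u * z v) w" for w
    proof (cases "w \<in> W")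
      case True
      then obtain u where u: "w = Some u" "u < n"
        by (auto simp: W_def)
      have "x w = ?f y u"
        using u y by blast
      also have "\<dots> = ?f (\<lambda>u. z (Some u)) u"
        using u(2) by (simp add: zy del: One_nat_def)
      also have "\<dots> = (\<Sum>v\<in>W. laplacian C v (Some u) * z v)"
        by (rule sum[OF u(2), symmetric])
      finally show ?thesis
        using True unfolding u(1) by simp
    next
      case False
      then show ?thesis
        using x by (auto simp: PiE_iff extensional_def)
    qed
    moreover have "z \<in> carrier (product_group W (\<lambda>_. integer_group))"
      by (auto simp: z_def)
    ultimately show "x \<in> transpose_image W (laplacian C)"
      unfolding transpose_image_def by (intro image_eqI[of _ _ z]) (rule ext, assumption)
  qed
qed

section \<open>The critical group\<close>

lemma critical_group_cone_cycle:
  fixes m l n :: nat and a b r d1 d2 :: int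
  assumes "n \<ge> 3" "r > 0" and l: "int l = r * b" and m: "int m + 2 * int l = r * a"
    and cokernel: "\<exists>\<phi> \<chi>. \<phi> 0 * \<chi> 1 - \<phi> 1 * \<chi> 0 = 1 \<and>
      (\<forall>x. x \<in> circulant_image n a b \<longleftrightarrow>
        d1 dvd (\<Sum>u<n. \<phi> u * x u) \<and> d2 dvd (\<Sum>u<n. \<chi> u * x u))"
  shows "critical_group (cone m (duplication l (cycle_graph n))) None \<cong>
    product_group {..<n - 2} (\<lambda>_. Zmod r) \<times>\<times> Zmod (r * d1) \<times>\<times> Zmod (r * d2)"
proof -
  define C where "C = cone m (duplication l (cycle_graph n))"
  define k where "k = n - 2"
  define G where "G = product_group (Some ` {..<n}) (\<lambda>_. integer_group)"
  have n: "n = k + 2"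
    using assms(1) by (simp add: k_def)
  obtain \<phi> \<chi> where \<phi>\<chi>: "\<phi> 0 * \<chi> 1 - \<phi> 1 * \<chi> 0 = 1 \<and>
      (\<forall>x. x \<in> circulant_image n a b \<longleftrightarrow>
        d1 dvd (\<Sum>u<n. \<phi> u * x u) \<and> d2 dvd (\<Sum>u<n. \<chi> u * x u))"
    using cokernel by (elim exE)
  note det = \<phi>\<chi>[THEN conjunct1] and img = \<phi>\<chi>[THEN conjunct2, rule_format]
  have scaled: "z \<in> circulant_image n (r * a) (r * b) \<longleftrightarrow> (\<forall>i<k. r dvd z (i + 2)) \<and>
      r * d1 dvd (\<Sum>u<n. \<phi> u * z u) \<and> r * d2 dvd (\<Sum>u<n. \<chi> u * z u)" for z
    unfolding n using \<open>r > 0\<close> det img[unfolded n] by (rule circulant_cokernel_scaled)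
  have "verts C - {None} = Some ` {..<n}"
    by (auto simp: C_def cone_def duplication_def cycle_graph_def)
  then have "critical_group C None = G Mod transpose_image (Some ` {..<n}) (laplacian C)"
    by (simp add: critical_group_def G_def)
  also have "transpose_image (Some ` {..<n}) (laplacian C) =
    {x \<in> carrier G. (\<forall>i<k. r dvd x (Some (i + 2))) \<and>
      r * d1 dvd (\<Sum>u<n. \<phi> u * x (Some u)) \<and> r * d2 dvd (\<Sum>u<n. \<chi> u * x (Some u))}"
    (is "?A = ?B")
  proof -
    have sub: "?A \<subseteq> carrier G"
      by (auto simp: transpose_image_def G_def)
    have "x \<in> ?A \<longleftrightarrow> (\<lambda>u. x (Some u)) \<in> circulant_image n (r * a) (r * b)" if "x \<in> carrier G" for x
      using transpose_image_cone_cycle[OF assms(1) that[unfolded G_def], of m l]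
      unfolding C_def m unfolding l .
    then have mem: "x \<in> ?A \<longleftrightarrow> (\<forall>i<k. r dvd x (Some (i + 2))) \<and>
        r * d1 dvd (\<Sum>u<n. \<phi> u * x (Some u)) \<and> r * d2 dvd (\<Sum>u<n. \<chi> u * x (Some u))"
      if "x \<in> carrier G" for x
      unfolding scaled using that .
    show ?thesis
    proof (rule Set.set_eqI)
      show "x \<in> ?A \<longleftrightarrow> x \<in> ?B" for x
      proof (cases "x \<in> carrier G")
        case True
        then show ?thesis
          by (simp only: mem mem_Collect_eq simp_thms)
      next
        case False
        then show ?thesis
          using contra_subsetD[OF sub False] by (simp only: mem_Collect_eq simp_thms)
      qed
    qed
  qed
  finally have quotient: "critical_group C None = G Mod {x \<in> carrier G. (\<forall>i<k. r dvd x (Some (i + 2))) \<and>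
      r * d1 dvd (\<Sum>u<n. \<phi> u * x (Some u)) \<and> r * d2 dvd (\<Sum>u<n. \<chi> u * x (Some u))}" .
  show ?thesis
    unfolding C_def[symmetric] k_def[symmetric] quotient unfolding G_def n
    by (rule integer_product_quotient) (rule det)
qed

text \<open>\<open>f_k\<close> is homogeneous of degree \<open>k\<close>, so the common factor comes
  out as \<open>r ^ k\<close>.\<close>

lemma eval2_fpoly_lucas: "eval2 (fpoly (int k)) (r * a) (- (r * b)) = r ^ k * lucas a b k"
proof (induction k rule: less_induct)
  case (less k)
  consider "k = 0" | "k = 1" | i where "k = Suc (Suc i)"
    by (metis One_nat_def not0_implies_Suc)
  then show ?case
  proof cases
    case 3
    have "int k - 1 = int (Suc i)" "int k - 2 = int i" "int k \<ge> 1"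
      using 3 by auto
    then have "eval2 (fpoly (int k)) (r * a) (- (r * b)) =
        r * a * (r ^ Suc i * lucas a b (Suc i)) - (- (r * b))\<^sup>2 * (r ^ i * lucas a b i)"
      using less[of "Suc i"] less[of i] 3 by (simp only: eval2_fpoly(3))
    then show ?thesis
      using 3 by (simp add: power2_eq_square algebra_simps)
  qed (simp_all add: eval2_fpoly)
qed

theorem corollary3p2:
  fixes m l n q :: nat and r s t :: int
  assumes "l \<ge> 1" and "n \<ge> 4"
  defines "K \<equiv> critical_group (cone m (duplication l (cycle_graph n))) None"
    and "r \<equiv> int (gcd l m)"
    and "s \<equiv> s_val l m q"
    and "t \<equiv> t_val l m q"
  shows
    "(n - 2 = 2 * q + 1 \<longrightarrow>
        K \<cong> product_group {..<n - 2} (\<lambda>_. Zmod r) \<times>\<times> Zmod (r * s) \<times>\<times> Zmod (int m * s)) \<and>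
     (n - 2 = 2 * q \<and> odd (int m div r) \<longrightarrow>
        K \<cong> product_group {..<n - 2} (\<lambda>_. Zmod r) \<times>\<times> Zmod (r * t) \<times>\<times>
              Zmod (int m * (int m + 4 * int l) * t div r)) \<and>
     (n - 2 = 2 * q \<and> even (int m div r) \<longrightarrow>
        K \<cong> product_group {..<n - 2} (\<lambda>_. Zmod r) \<times>\<times> Zmod (2 * r * t) \<times>\<times>
              Zmod (int m * (int m + 4 * int l) * t div (2 * r)))"
proof -
  have r: "r > 0" and n: "n \<ge> 3"
    using assms(1,2) by (simp_all add: r_def)
  obtain b c where bc: "int l = r * b" "int m = r * c"
    by (metis dvdE gcd_dvd1 gcd_dvd2 of_nat_dvd_iff r_def)
  have "r = gcd (int l) (int m)"
    by (simp add: r_def)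
  also have "\<dots> = r * gcd b c"
    unfolding bc using r by (simp add: gcd_mult_distrib_int[symmetric])
  finally have "coprime b c"
    using r by (simp add: coprime_iff_gcd_eq_1)
  define a where "a = c + 2 * b"
  have cop: "coprime a b"
    using \<open>coprime b c\<close> coprime_add_multiple[of c b 2] by (simp add: a_def mult.commute[of b] coprime_commute[of c])
  have m: "int m + 2 * int l = r * a"
    by (simp add: bc a_def algebra_simps)
  have s: "s = lucas a b (q + 1) + b * lucas a b q"
  proof -
    have "s * r ^ (q + 1) = r ^ (q + 1) * (lucas a b (q + 1) + b * lucas a b q)"
      using s_val_exact[of l m q] eval2_fpoly_lucas[of "q + 1" r a b] eval2_fpoly_lucas[of q r a b]
      unfolding s_def[symmetric] r_def[symmetric] m unfolding bc(1) by (simp add: algebra_simps)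
    then show ?thesis
      using r by simp
  qed
  have t: "t = lucas a b q"
  proof -
    have "t * r ^ q = r ^ q * lucas a b q"
      using t_val_exact[of l m q] eval2_fpoly_lucas[of q r a b]
      unfolding t_def[symmetric] r_def[symmetric] m unfolding bc(1) by simp
    then show ?thesis
      using r by simp
  qed
  have c: "int m div r = c" and c_parity: "even c \<longleftrightarrow> even a"
    using r by (simp_all add: bc a_def)
  \<comment> \<open>Here \<open>m * (m + 4 * l)\<close> is \<open>r * r * c * (c + 4 * b)\<close>,
    where \<open>c = a - 2 * b\<close> and \<open>c + 4 * b = a + 2 * b\<close>.\<close>
  have last: "int m * (int m + 4 * int l) * t = r * (r * (t * (a\<^sup>2 - (2 * b)\<^sup>2)))"
    by (simp add: bc a_def power2_eq_square algebra_simps)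
  note iso = critical_group_cone_cycle[OF n r bc(1) m, folded K_def]
  have "K \<cong> product_group {..<n - 2} (\<lambda>_. Zmod r) \<times>\<times> Zmod (r * s) \<times>\<times> Zmod (int m * s)"
    if "n - 2 = 2 * q + 1"
  proof -
    have "n = 2 * q + 3"
      using that n by simp
    \<comment> \<open>The last factor is \<open>m * s\<close> because
      \<open>r * (a - 2 * b) = r * c = m\<close>.\<close>
    with iso[of s "s * (a - 2 * b)"] circulant_cokernel_odd[OF cop, of q] show ?thesis
      by (simp add: s a_def bc mult_ac)
  qed
  moreover have "K \<cong> product_group {..<n - 2} (\<lambda>_. Zmod r) \<times>\<times> Zmod (r * t) \<times>\<times>
      Zmod (int m * (int m + 4 * int l) * t div r)"
    if "n - 2 = 2 * q" "odd (int m div r)"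
  proof -
    \<comment> \<open>For odd \<open>a\<close> the entries \<open>a\<close> and \<open>2 * b\<close>
      are coprime, so \<open>g = 1\<close>.\<close>
    have "coprime a (2 * b)"
      using that cop c c_parity by (simp add: coprime_right_2_iff_odd)
    then obtain u v where "u * a + v * (2 * b) = 1"
      using bezout_int[of a "2 * b"] by auto
    moreover have "n = 2 * q + 2"
      using that n by simp
    moreover have "int m * (int m + 4 * int l) * t div r = r * (t * (a\<^sup>2 - (2 * b)\<^sup>2))"
      unfolding last using r by simp
    ultimately show ?thesis
      using iso[of "t * 1" "t * (1 * (a\<^sup>2 - (2 * b)\<^sup>2))"]
        circulant_cokernel_even[OF cop, of 1 a "2 * b" u v q] by (simp add: t)
  qed
  moreover have "K \<cong> product_group {..<n - 2} (\<lambda>_. Zmod r) \<times>\<times> Zmod (2 * r * t) \<times>\<times>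
      Zmod (int m * (int m + 4 * int l) * t div (2 * r))"
    if "n - 2 = 2 * q" "even (int m div r)"
  proof -
    \<comment> \<open>For even \<open>a\<close> their greatest common divisor is 2, so
      \<open>g = 2\<close> and \<open>b1 = b\<close>.\<close>
    have "even a"
      using that(2) unfolding c c_parity .
    then obtain a1 where a1: "a = 2 * a1"
      by (rule evenE)
    then have "coprime a1 b"
      using cop by simp
    then obtain u v where "u * a1 + v * b = 1"
      using bezout_int[of a1 b] by auto
    moreover have "n = 2 * q + 2"
      using that n by simp
    moreover have eq: "int m * (int m + 4 * int l) * t = 2 * r * (r * (t * (2 * (a1\<^sup>2 - b\<^sup>2))))"
      unfolding last a1 by (simp add: power2_eq_square algebra_simps)
    have "int m * (int m + 4 * int l) * t div (2 * r) = r * (t * (2 * (a1\<^sup>2 - b\<^sup>2)))"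
      unfolding eq using r by (intro nonzero_mult_div_cancel_left) simp
    moreover have "r * (t * 2) = 2 * r * t"
      by simp
    ultimately show ?thesis
      using iso[of "t * 2" "t * (2 * (a1\<^sup>2 - b\<^sup>2))"]
        circulant_cokernel_even[OF cop a1 refl dvd_refl, of u v q] by (simp only: t)
  qed
  ultimately show ?thesis
    by blast
qed

end
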